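(* Let $\Omega$ be a $(K,\delta)$-dense sampling scheme, let $M\in\mathbb N$ with $M\le 2K$, let $$\mathcal U_M=\operatorname{span}\{\sqrt M\,\phi(M\cdot-m):m=0,\dots,M-1\},\qquad \phi=\mathbb 1_{[0,1]},$$ and let $\mathcal T\subseteq\mathcal U_M$ be a (nonzero) subspace. Then: (i) if $2K/M\in\mathbb N$, then $C(\Omega,\mathcal T)\le\frac{\pi}{2}\cdot\frac{1+\delta}{1-\delta}$; (ii) if $2K/M\notin\mathbb N$ and $M\ge2$, then $C(\Omega,\mathcal T)\le c_0\frac{1+\delta}{1-\delta}$ with $c_0=\dfrac{1}{\operatorname{sinc}(\pi/2+\pi\delta/M)}$. In particular $c_0\sim\pi/2$ for $M\gg1$.
   Context: For $f\in L^2(\mathbb R)$, $\hat f(\omega)=\int_{\mathbb R}f(x)e^{-2\pi i\omega x}\,dx$; $\langle\cdot,\cdot\rangle$, $\|\cdot\|$ are the $L^2(\mathbb R)$ inner product and norm; $\operatorname{sinc}(x)=\sin(x)/x$. $\mathcal H=\{f\in L^2(\mathbb R):\operatorname{supp}f\subseteq[0,1]\}$. $(K,\delta)$-density: for $K>0$, $0<\delta<1$, a finite set $\Omega=\{\omega_1<\dots<\omega_N\}\subset\mathbb R$ is $(K,\delta)$-dense if $\Omega\subseteq[-K,K]$ and $\max_{n=0,\dots,N}(\omega_{n+1}-\omega_n)\le\delta$, where $\omega_0=\omega_N-2K$, $\omega_{N+1}=\omega_1+2K$. Sampling operator: $\mathcal Sf(x)=\sum_{n=1}^N\mu_n\hat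 f(\omega_n)e^{2\pi i\omega_nx}\mathbb 1_{[0,1]}(x)$, $\mu_n=\tfrac12(\omega_{n+1}-\omega_{n-1})$. $C_1(\Omega,\mathcal T)=\inf_{0\ne f\in\mathcal T}\langle\mathcal Sf,f\rangle/\|f\|^2$, $C_2(\Omega)=\sup_{0\ne f\in\mathcal H}\langle\mathcal Sf,f\rangle/\|f\|^2$, $C(\Omega,\mathcal T)=\sqrt{C_2/C_1}$. *)

theory Defs
  imports "HOL-Analysis.Analysis"
begin

definition sinc_fn :: "real \<Rightarrow> real" where
  "sinc_fn x = sin x / x"

definition is_L2 :: "(real \<Rightarrow> complex) \<Rightarrow> bool" where
  "is_L2 f \<longleftrightarrow> f \<in> borel_measurable lborel \<and> integrable lborel (\<lambda>x. (cmod (f x))^2)"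

definition L2_inner :: "(real \<Rightarrow> complex) \<Rightarrow> (real \<Rightarrow> complex) \<Rightarrow> complex" where
  "L2_inner g f = (LINT x|lborel. g x * cnj (f x))"

definition L2_norm :: "(real \<Rightarrow> complex) \<Rightarrow> real" where
  "L2_norm f = sqrt (LINT x|lborel. (cmod (f x))^2)"

definition fourier :: "(real \<Rightarrow> complex) \<Rightarrow> real \<Rightarrow> complex" where
  "fourier f w = (LINT x|lborel. f x * exp (- 2 * pi * \<i> * complex_of_real (w * x)))"

definition H_space :: "(real \<Rightarrow> complex) set" where
  "H_space = {f. is_L2 f \<and> (\<forall>x. x \<notin> {0..1} \<longrightarrow> f x = 0)}"

definition U_space :: "nat \<Rightarrow> (real \<Rightarrow> complex) set" where
  "U_space M = {(\<lambda>x. \<Sum>m<M. c m * complex_of_real (sqrt (real M))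
                    * indicator {0..1::real} (real M * x - real m)) | c. True}"

definition is_csubspace :: "(real \<Rightarrow> complex) set \<Rightarrow> bool" where
  "is_csubspace T \<longleftrightarrow> (\<lambda>x. 0) \<in> T \<and> (\<forall>f\<in>T. \<forall>g\<in>T. (\<lambda>x. f x + g x) \<in> T)
     \<and> (\<forall>c. \<forall>f\<in>T. (\<lambda>x. c * f x) \<in> T)"

text \<open>Sampling scheme Omega = {w 1 < ... < w N}, given by a strictly increasing
  function w on {1..N}; extended by w_0 = w_N - 2K, w_{N+1} = w_1 + 2K.\<close>
definition omega_ext :: "real \<Rightarrow> nat \<Rightarrow> (nat \<Rightarrow> real) \<Rightarrow> nat \<Rightarrow> real" where
  "omega_ext K N w n =
     (if n = 0 then w N - 2 * K else if n = N + 1 then w 1 + 2 * K else w n)"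

definition KD_dense :: "real \<Rightarrow> real \<Rightarrow> nat \<Rightarrow> (nat \<Rightarrow> real) \<Rightarrow> bool" where
  "KD_dense K \<delta> N w \<longleftrightarrow> 0 < K \<and> 0 < \<delta> \<and> \<delta> < 1 \<and> 1 \<le> N \<and>
     strict_mono_on {1..N} w \<and> (\<forall>n\<in>{1..N}. w n \<in> {-K..K}) \<and>
     (\<forall>n\<le>N. omega_ext K N w (n + 1) - omega_ext K N w n \<le> \<delta>)"

definition mu_weight :: "real \<Rightarrow> nat \<Rightarrow> (nat \<Rightarrow> real) \<Rightarrow> nat \<Rightarrow> real" where
  "mu_weight K N w n = (omega_ext K N w (n + 1) - omega_ext K N w (n - 1)) / 2"

definition sampling_op :: "real \<Rightarrow> nat \<Rightarrow> (nat \<Rightarrow> real) \<Rightarrow> (real \<Rightarrow> complex) \<Rightarrow> real \<Rightarrow> complex" where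
  "sampling_op K N w f x = (\<Sum>n=1..N. complex_of_real (mu_weight K N w n) * fourier f (w n)
       * exp (2 * pi * \<i> * complex_of_real (w n * x)) * indicator {0..1::real} x)"

definition Sratio :: "real \<Rightarrow> nat \<Rightarrow> (nat \<Rightarrow> real) \<Rightarrow> (real \<Rightarrow> complex) \<Rightarrow> real" where
  "Sratio K N w f = Re (L2_inner (sampling_op K N w f) f) / (L2_norm f)^2"

definition C1 :: "real \<Rightarrow> nat \<Rightarrow> (nat \<Rightarrow> real) \<Rightarrow> (real \<Rightarrow> complex) set \<Rightarrow> real" where
  "C1 K N w T = Inf {Sratio K N w f | f. f \<in> T \<and> L2_norm f \<noteq> 0}"

definition C2 :: "real \<Rightarrow> nat \<Rightarrow> (nat \<Rightarrow> real) \<Rightarrow> real" where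
  "C2 K N w = Sup {Sratio K N w f | f. f \<in> H_space \<and> L2_norm f \<noteq> 0}"

definition Cconst :: "real \<Rightarrow> nat \<Rightarrow> (nat \<Rightarrow> real) \<Rightarrow> (real \<Rightarrow> complex) set \<Rightarrow> real" where
  "Cconst K N w T = sqrt (C2 K N w / C1 K N w T)"

end

theory Submission
  imports Defs
begin

text \<open>On each half cell of the sampling scheme Wirtinger's inequality bounds the distance between a
  function and its value at the node by \<open>\<delta>/pi\<close> times the norm of its derivative. For a
  function with frequencies in \<open>[-1/2, 1/2]\<close> this compares the weighted sum of squared samples with the
  square integral up to factors \<open>(1 \<plusminus> \<delta>)\<^sup>2\<close>. Bessel's inequality thus gives \<open>C2 \<le> (1 + \<delta>)\<^sup>2\<close>.
  For the lower bound, the transform of a step function is sinc times an (up to phase) \<open>M\<close>-periodic trigonometric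
  polynomial, so it suffices to sample that polynomial over one period where sinc is not too small:
  over nodes of modulus at most \<open>M/2\<close> if \<open>2K = M\<close>, at most \<open>M/2 + \<delta>\<close> in general, and, if \<open>2K \<ge> 2M\<close>,
  over \<open>[-M, M]\<close> with a cosine window below sinc whose shifts by \<open>M\<close> have squares adding up to a constant.\<close>

section \<open>Sampling of differentiable curves\<close>

text \<open>Two obstacles shape the lower bound. Sinc decays, so nodes far from 0 have to be
  discarded, yet those that remain must cover a full period of length \<open>M\<close>; and the
  nodes do not repeat modulo \<open>M\<close>. Cutting at nodes makes the range overhang by up to
  \<delta> on either side. The constant is the reciprocal of sinc at the largest frequency kept:
  \<open>M/2\<close> yields \<open>pi/2\<close>, and \<open>M/2 + \<delta>\<close> yields the
  constant \<open>c_0\<close>. A window that vanishes at both ends can be cut exactly, without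
  overhang, which recovers \<open>pi/2\<close> when there is room for two periods. The factors
  \<open>1 + \<delta>\<close> and \<open>1 - \<delta>\<close> are due to centring: functions on an
  interval of length 1 are moved to \<open>[-1/2, 1/2]\<close>, so that differentiating the
  transform costs at most a factor \<open>pi\<close>, which cancels the \<open>pi\<close> in
  Wirtinger's constant and leaves a relative error of \<delta>.\<close>

locale C1_curve =
  fixes u u' :: "real \<Rightarrow> complex"
  assumes deriv: "\<And>t. (u has_vector_derivative u' t) (at t)"
    and cont_deriv: "continuous_on UNIV u'"
begin

lemma cont: "continuous_on S u"
  by (meson deriv continuous_at_imp_continuous_on has_vector_derivative_continuous)

lemma cont_deriv_on: "continuous_on S u'"
  using cont_deriv continuous_on_subset by blast

text \<open>Time reversal carries every estimate anchored at a left endpoint over to the right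
  endpoint.\<close>

lemma reflected: "C1_curve (\<lambda>t. u (- t)) (\<lambda>t. - u' (- t))"
proof
  fix t
  have "(uminus has_vector_derivative - 1) (at t)"
    by (auto intro!: derivative_eq_intros)
  then have "((\<lambda>t. u (- t)) has_vector_derivative (-1) *\<^sub>R u' (- t)) (at t)"
    using vector_diff_chain_at[of uminus "-1" t u "u' (- t)"] deriv[of "- t"]
    by (simp add: o_def)
  then show "((\<lambda>t. u (- t)) has_vector_derivative - u' (- t)) (at t)" by simp
next
  show "continuous_on UNIV (\<lambda>t. - u' (- t))"
    by (intro continuous_intros continuous_on_compose2[OF cont_deriv]) auto
qed

section \<open>Wirtinger's inequality with one endpoint pinned\<close>

lemma int_sq: "(\<lambda>t. (cmod (u t))\<^sup>2) integrable_on {a..b}"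
  by (intro integrable_continuous_interval continuous_intros cont)

lemma int_deriv_sq: "(\<lambda>t. (cmod (u' t))\<^sup>2) integrable_on {a..b}"
  by (intro integrable_continuous_interval continuous_intros cont_deriv_on)

lemma int_diff_sq: "(\<lambda>t. (cmod (u t - c))\<^sup>2) integrable_on {a..b}"
  by (intro integrable_continuous_interval continuous_intros cont)

text \<open>With \<open>p(t) = \<beta> tan (\<beta> (b - t))\<close> and \<open>v = u - u(a)\<close>, the derivative of \<open>p \<bar>v\<bar>\<^sup>2\<close> is
  \<open>\<bar>v'\<bar>\<^sup>2 - \<beta>\<^sup>2 \<bar>v\<bar>\<^sup>2 - \<bar>v' - p v\<bar>\<^sup>2\<close>, and \<open>p \<bar>v\<bar>\<^sup>2\<close> vanishes at both ends.\<close>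

lemma wirtinger_subcritical:
  assumes "a \<le> b" "0 < \<beta>" "\<beta> * (b - a) < pi / 2"
  shows "\<beta>\<^sup>2 * integral {a..b} (\<lambda>t. (cmod (u t - u a))\<^sup>2) \<le> integral {a..b} (\<lambda>t. (cmod (u' t))\<^sup>2)"
proof -
  define v where "v = (\<lambda>t. u t - u a)"
  define p where "p = (\<lambda>t. \<beta> * tan (\<beta> * (b - t)))"
  define G' where "G' = (\<lambda>t. (cmod (u' t))\<^sup>2 - \<beta>\<^sup>2 * (cmod (v t))\<^sup>2 - (cmod (u' t - p t *\<^sub>R v t))\<^sup>2)"
  have "((\<lambda>t. p t * (v t \<bullet> v t)) has_real_derivative G' t) (at t within {a..b})"
    if t: "t \<in> {a..b}" for t
  proof -
    have "\<beta> * (b - t) \<le> \<beta> * (b - a)" using t assms by (intro mult_left_mono) auto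
    moreover have "0 \<le> \<beta> * (b - t)" using t assms by simp
    ultimately have c: "cos (\<beta> * (b - t)) > 0"
      using assms pi_gt_zero by (intro cos_gt_zero_pi) linarith+
    have dv: "(v has_vector_derivative u' t) (at t within {a..b})"
      unfolding v_def by (auto intro!: derivative_eq_intros has_vector_derivative_at_within[OF deriv])
    have dvv: "((\<lambda>t. v t \<bullet> v t) has_real_derivative 2 * (v t \<bullet> u' t)) (at t within {a..b})"
      using has_derivative_inner[OF dv[unfolded has_vector_derivative_def] dv[unfolded has_vector_derivative_def]]
      unfolding has_field_derivative_def
      by (rule has_derivative_eq_rhs) (auto simp: inner_commute algebra_simps fun_eq_iff)
    have dp: "(p has_real_derivative - \<beta>\<^sup>2 - (p t)\<^sup>2) (at t within {a..b})"
      unfolding p_def using c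
      by (auto intro!: derivative_eq_intros simp: power2_eq_square tan_def field_simps)
    have "((\<lambda>t. p t * (v t \<bullet> v t)) has_real_derivative
        ((- \<beta>\<^sup>2 - (p t)\<^sup>2) * (v t \<bullet> v t) + (2 * (v t \<bullet> u' t)) * p t)) (at t within {a..b})"
      by (rule DERIV_mult[OF dp dvv])
    moreover have "(- \<beta>\<^sup>2 - (p t)\<^sup>2) * (v t \<bullet> v t) + (2 * (v t \<bullet> u' t)) * p t = G' t"
      unfolding G'_def dot_square_norm[symmetric] by (simp add: inner_commute power2_eq_square algebra_simps)
    ultimately show ?thesis by simp
  qed
  then have "(G' has_integral p b * (v b \<bullet> v b) - p a * (v a \<bullet> v a)) {a..b}"
    using assms(1) by (intro fundamental_theorem_of_calculus) (auto simp: has_real_derivative_iff_has_vector_derivative)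
  then have G0: "(G' has_integral 0) {a..b}" by (simp add: p_def v_def)
  have "0 \<le> integral {a..b} (\<lambda>t. (cmod (u' t))\<^sup>2 - \<beta>\<^sup>2 * (cmod (u t - u a))\<^sup>2)"
    by (rule has_integral_le[OF G0 integrable_integral])
      (auto simp: G'_def v_def intro!: integrable_diff int_deriv_sq integrable_on_mult_right int_diff_sq)
  also have "\<dots> = integral {a..b} (\<lambda>t. (cmod (u' t))\<^sup>2) - \<beta>\<^sup>2 * integral {a..b} (\<lambda>t. (cmod (u t - u a))\<^sup>2)"
    by (simp add: integral_diff[OF int_deriv_sq integrable_on_mult_right[OF int_diff_sq]])
  finally show ?thesis by simp
qed

text \<open>Only the left end is pinned, so the extremal is a quarter sine wave. The constant
  belongs to \<open>\<beta> = pi / (2 * (b - a))\<close>, where the tangent of the subcritical proof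
  has a pole at \<open>a\<close>; hence it is reached as a limit.\<close>

lemma wirtinger:
  assumes "a \<le> b"
  shows "integral {a..b} (\<lambda>t. (cmod (u t - u a))\<^sup>2) \<le> (2 * (b - a) / pi)\<^sup>2 * integral {a..b} (\<lambda>t. (cmod (u' t))\<^sup>2)"
proof (cases "a = b")
  case False
  let ?A = "integral {a..b} (\<lambda>t. (cmod (u t - u a))\<^sup>2)"
  let ?B = "integral {a..b} (\<lambda>t. (cmod (u' t))\<^sup>2)"
  have L: "b - a > 0" using False assms by simp
  have "(pi / (2 * (b - a)))\<^sup>2 * ?A \<le> ?B"
  \<comment> \<open>Scaling the critical value of \<open>\<beta>\<^sup>2\<close> by
    \<open>z < 1\<close> keeps \<beta> subcritical; \<open>z\<close> then tends to 1.\<close>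
  proof (rule field_le_mult_one_interval)
    fix z :: real assume z: "0 < z" "z < 1"
    define \<beta> where "\<beta> = sqrt z * (pi / (2 * (b - a)))"
    have "\<beta> * (b - a) = sqrt z * (pi / 2)" using L by (simp add: \<beta>_def field_simps)
    also have "\<dots> < 1 * (pi / 2)" using z by (intro mult_strict_right_mono) auto
    finally have "\<beta>\<^sup>2 * ?A \<le> ?B" using z L by (intro wirtinger_subcritical assms) (auto simp: \<beta>_def)
    moreover have "\<beta>\<^sup>2 = z * (pi / (2 * (b - a)))\<^sup>2" using z by (simp add: \<beta>_def power_mult_distrib power_divide)
    ultimately show "z * ((pi / (2 * (b - a)))\<^sup>2 * ?A) \<le> ?B" by (simp add: mult.assoc)
  qed
  then have "(2 * (b - a) / pi)\<^sup>2 * ((pi / (2 * (b - a)))\<^sup>2 * ?A) \<le> (2 * (b - a) / pi)\<^sup>2 * ?B"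
    by (rule mult_left_mono) simp
  moreover have "(2 * (b - a) / pi)\<^sup>2 * (pi / (2 * (b - a)))\<^sup>2 = 1"
    using L by (simp add: power_mult_distrib[symmetric])
  ultimately show ?thesis by (simp add: mult.assoc[symmetric])
qed simp

text \<open>Used with \<open>\<epsilon> = \<delta>\<close> for upper and \<open>\<epsilon> = -\<delta>\<close> for lower bounds; if \<open>u\<close> has
  frequencies in \<open>[-1/2, 1/2]\<close> this is \<open>(1 + \<delta>)\<^sup>2\<close>, respectively \<open>(1 - \<delta>)\<^sup>2\<close>, times the square integral of \<open>u\<close> at worst.\<close>

definition energy :: "real \<Rightarrow> real \<Rightarrow> real \<Rightarrow> real" where
  "energy \<epsilon> a b = (1 + \<epsilon>) * (integral {a..b} (\<lambda>t. (cmod (u t))\<^sup>2) + \<epsilon> / pi\<^sup>2 * integral {a..b} (\<lambda>t. (cmod (u' t))\<^sup>2))"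

section \<open>Energy over half cells, gaps and overlapping gaps\<close>

lemma energy_combine:
  assumes "a \<le> c" "c \<le> b"
  shows "energy \<epsilon> a b = energy \<epsilon> a c + energy \<epsilon> c b"
  unfolding energy_def
    Henstock_Kurzweil_Integration.integral_combine[OF assms int_sq, symmetric]
    Henstock_Kurzweil_Integration.integral_combine[OF assms int_deriv_sq, symmetric]
  by (simp add: algebra_simps)

lemma wirtinger_half_cell:
  assumes "a \<le> b" "b - a \<le> \<delta> / 2"
  shows "integral {a..b} (\<lambda>t. (cmod (u t - u a))\<^sup>2) \<le> \<delta>\<^sup>2 / pi\<^sup>2 * integral {a..b} (\<lambda>t. (cmod (u' t))\<^sup>2)"
proof -
  have "(2 * (b - a) / pi)\<^sup>2 \<le> (\<delta> / pi)\<^sup>2"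
    using assms by (intro power_mono divide_right_mono) auto
  then have "(2 * (b - a) / pi)\<^sup>2 * integral {a..b} (\<lambda>t. (cmod (u' t))\<^sup>2)
      \<le> \<delta>\<^sup>2 / pi\<^sup>2 * integral {a..b} (\<lambda>t. (cmod (u' t))\<^sup>2)"
    by (intro mult_right_mono integral_nonneg int_deriv_sq) (auto simp: power_divide)
  with wirtinger[OF assms(1)] show ?thesis by linarith
qed

lemma half_cell_upper:
  assumes "a \<le> b" "b - a \<le> \<delta> / 2" "0 < \<delta>"
  shows "(b - a) * (cmod (u a))\<^sup>2 \<le> energy \<delta> a b"
proof -
  let ?E = "integral {a..b} (\<lambda>t. (cmod (u t))\<^sup>2)"
  let ?D = "integral {a..b} (\<lambda>t. (cmod (u t - u a))\<^sup>2)"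
  let ?E' = "integral {a..b} (\<lambda>t. (cmod (u' t))\<^sup>2)"
  have "(b - a) * (cmod (u a))\<^sup>2 = integral {a..b} (\<lambda>t. (cmod (u a))\<^sup>2)" using assms by simp
  \<comment> \<open>Young's inequality with weight \<delta>: Wirtinger contributes
    \<open>\<delta>\<^sup>2\<close>, and \<open>(1 + 1 / \<delta>) * \<delta>\<^sup>2 = (1 +
    \<delta>) * \<delta>\<close>, so both terms share the factor \<open>1 + \<delta>\<close> of
    \<open>energy\<close>.\<close>
  also have "\<dots> \<le> integral {a..b} (\<lambda>t. (1 + \<delta>) * (cmod (u t))\<^sup>2 + (1 + 1 / \<delta>) * (cmod (u t - u a))\<^sup>2)"
  proof (rule integral_le)
    fix t
    define x where "x = cmod (u t)" define y where "y = cmod (u t - u a)"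
    have "cmod (u a) \<le> x + y" using norm_triangle_sub[of "u a" "u t"] by (simp add: x_def y_def norm_minus_commute)
    then have "(cmod (u a))\<^sup>2 \<le> (x + y)\<^sup>2" by (intro power_mono) auto
    also have "\<dots> = (1 + \<delta>) * x\<^sup>2 + (1 + 1 / \<delta>) * y\<^sup>2 - (\<delta> * x - y)\<^sup>2 / \<delta>"
      using assms by (simp add: field_simps power2_eq_square)
    also have "\<dots> \<le> (1 + \<delta>) * x\<^sup>2 + (1 + 1 / \<delta>) * y\<^sup>2" using assms by simp
    finally show "(cmod (u a))\<^sup>2 \<le> (1 + \<delta>) * (cmod (u t))\<^sup>2 + (1 + 1 / \<delta>) * (cmod (u t - u a))\<^sup>2"
      by (simp add: x_def y_def)
  qed (auto intro!: integrable_add integrable_on_mult_right int_sq int_diff_sq)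
  also have "\<dots> = (1 + \<delta>) * ?E + (1 + 1 / \<delta>) * ?D"
    by (subst integral_add) (auto intro!: integrable_on_mult_right int_sq int_diff_sq)
  also have "\<dots> \<le> (1 + \<delta>) * ?E + (1 + 1 / \<delta>) * (\<delta>\<^sup>2 / pi\<^sup>2 * ?E')"
    using assms by (intro add_left_mono mult_left_mono wirtinger_half_cell) auto
  also have "\<dots> = energy \<delta> a b"
    using assms by (simp add: energy_def field_simps power2_eq_square)
  finally show ?thesis .
qed

lemma half_cell_lower:
  assumes "a \<le> b" "b - a \<le> \<delta> / 2" "0 < \<delta>" "\<delta> < 1"
  shows "energy (- \<delta>) a b \<le> (b - a) * (cmod (u a))\<^sup>2"
proof -
  let ?E = "integral {a..b} (\<lambda>t. (cmod (u t))\<^sup>2)"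
  let ?D = "integral {a..b} (\<lambda>t. (cmod (u t - u a))\<^sup>2)"
  let ?E' = "integral {a..b} (\<lambda>t. (cmod (u' t))\<^sup>2)"
  \<comment> \<open>The weight \<open>(1 - \<delta>) / \<delta>\<close> is the one in \<open>(1 -
    \<delta>) * (x + y)\<^sup>2 \<le> x\<^sup>2 + (1 - \<delta>) / \<delta> * y\<^sup>2\<close>,
    which has equality at \<open>\<delta> * x = (1 - \<delta>) * y\<close>.\<close>
  have "energy (- \<delta>) a b = (1 - \<delta>) * ?E - (1 - \<delta>) / \<delta> * (\<delta>\<^sup>2 / pi\<^sup>2 * ?E')"
    using assms by (simp add: energy_def field_simps power2_eq_square)
  also have "\<dots> \<le> (1 - \<delta>) * ?E - (1 - \<delta>) / \<delta> * ?D"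
    using assms by (intro diff_left_mono mult_left_mono wirtinger_half_cell) auto
  also have "\<dots> = integral {a..b} (\<lambda>t. (1 - \<delta>) * (cmod (u t))\<^sup>2 - (1 - \<delta>) / \<delta> * (cmod (u t - u a))\<^sup>2)"
    by (subst Henstock_Kurzweil_Integration.integral_diff[OF integrable_on_mult_right[OF int_sq] integrable_on_mult_right[OF int_diff_sq]]) simp
  also have "\<dots> \<le> integral {a..b} (\<lambda>t. (cmod (u a))\<^sup>2)"
  proof (rule integral_le)
    fix t
    define x where "x = cmod (u a)" define y where "y = cmod (u t - u a)"
    have "cmod (u t) \<le> x + y" using norm_triangle_sub[of "u t" "u a"] by (simp add: x_def y_def)
    then have "(cmod (u t))\<^sup>2 \<le> (x + y)\<^sup>2" by (intro power_mono) auto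
    then have "(1 - \<delta>) * (cmod (u t))\<^sup>2 - (1 - \<delta>) / \<delta> * y\<^sup>2 \<le> (1 - \<delta>) * (x + y)\<^sup>2 - (1 - \<delta>) / \<delta> * y\<^sup>2"
      using assms by (intro diff_right_mono mult_left_mono) auto
    also have "\<dots> = x\<^sup>2 - (\<delta> * x - (1 - \<delta>) * y)\<^sup>2 / \<delta>"
      using assms by (simp add: field_simps power2_eq_square)
    also have "\<dots> \<le> x\<^sup>2" using assms by simp
    finally show "(1 - \<delta>) * (cmod (u t))\<^sup>2 - (1 - \<delta>) / \<delta> * (cmod (u t - u a))\<^sup>2 \<le> (cmod (u a))\<^sup>2"
      by (simp add: x_def y_def)
  qed (intro integrable_diff integrable_on_mult_right int_sq int_diff_sq integrable_const_ivl)+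
  also have "\<dots> = (b - a) * (cmod (u a))\<^sup>2" using assms by simp
  finally show ?thesis .
qed

lemma energy_reflected:
  "C1_curve.energy (\<lambda>t. u (- t)) (\<lambda>t. - u' (- t)) \<epsilon> (- b) (- a) = energy \<epsilon> a b"
proof -
  interpret r: C1_curve "\<lambda>t. u (- t)" "\<lambda>t. - u' (- t)" by (rule reflected)
  show ?thesis
    unfolding r.energy_def energy_def norm_minus_cancel
    using Henstock_Kurzweil_Integration.integral_reflect_real[of b a "\<lambda>t. (cmod (u t))\<^sup>2"] Henstock_Kurzweil_Integration.integral_reflect_real[of b a "\<lambda>t. (cmod (u' t))\<^sup>2"]
    by simp
qed

lemma half_cell_upper_right:
  assumes "a \<le> b" "b - a \<le> \<delta> / 2" "0 < \<delta>"
  shows "(b - a) * (cmod (u b))\<^sup>2 \<le> energy \<delta> a b"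
  using C1_curve.half_cell_upper[OF reflected, of "- b" "- a" \<delta>] assms by (simp add: energy_reflected)

lemma half_cell_lower_right:
  assumes "a \<le> b" "b - a \<le> \<delta> / 2" "0 < \<delta>" "\<delta> < 1"
  shows "energy (- \<delta>) a b \<le> (b - a) * (cmod (u b))\<^sup>2"
  using C1_curve.half_cell_lower[OF reflected, of "- b" "- a" \<delta>] assms by (simp add: energy_reflected)

lemma gap_upper:
  assumes "a \<le> b" "b - a \<le> \<delta>" "0 < \<delta>"
  shows "(b - a) / 2 * ((cmod (u a))\<^sup>2 + (cmod (u b))\<^sup>2) \<le> energy \<delta> a b"
proof -
  let ?m = "(a + b) / 2"
  have m: "?m - a = (b - a) / 2" "b - ?m = (b - a) / 2" by (simp_all add: field_simps)
  show ?thesis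
    using half_cell_upper[of a ?m \<delta>] half_cell_upper_right[of ?m b \<delta>] energy_combine[of a ?m b \<delta>] assms
    unfolding m distrib_left by simp
qed

lemma gap_lower:
  assumes "a \<le> b" "b - a \<le> \<delta>" "0 < \<delta>" "\<delta> < 1"
  shows "energy (- \<delta>) a b \<le> (b - a) / 2 * ((cmod (u a))\<^sup>2 + (cmod (u b))\<^sup>2)"
proof -
  let ?m = "(a + b) / 2"
  have m: "?m - a = (b - a) / 2" "b - ?m = (b - a) / 2" by (simp_all add: field_simps)
  show ?thesis
    using half_cell_lower[of a ?m \<delta>] half_cell_lower_right[of ?m b \<delta>] energy_combine[of a ?m b "- \<delta>"] assms
    unfolding m distrib_left by simp
qed

text \<open>The middle part, between the midpoints of the two overlapping gaps, can be estimated from either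
  of the two inner nodes alone; using the one with the smaller value avoids counting any energy twice.\<close>

lemma crossing_gaps_lower:
  assumes "r \<le> l" "l \<le> r'" "r' \<le> l'" "r' - r \<le> \<delta>" "l' - l \<le> \<delta>" "0 < \<delta>" "\<delta> < 1"
  shows "energy (- \<delta>) r l' \<le> (r' - r) / 2 * ((cmod (u r))\<^sup>2 + (cmod (u r'))\<^sup>2)
      + (l' - l) / 2 * ((cmod (u l))\<^sup>2 + (cmod (u l'))\<^sup>2)"
proof -
  define m where "m = (r + r') / 2"
  define m' where "m' = (l + l') / 2"
  have le: "r \<le> m" "m \<le> r'" "l \<le> m'" "m' \<le> l'" "m \<le> m'" using assms by (auto simp: m_def m'_def)
  have half: "m - r = (r' - r) / 2" "r' - m = (r' - r) / 2" "m' - l = (l' - l) / 2" "l' - m' = (l' - l) / 2"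
    by (simp_all add: m_def m'_def field_simps)
  \<comment> \<open>If an inner node lies in the outer half of the other gap, the half cell of the
    outer node there reaches it and one complete gap remains. Otherwise both inner nodes lie between
    the midpoints.\<close>
  consider "l \<le> m" | "m' \<le> r'" | "m < l" "r' < m'" by linarith
  then show ?thesis
  proof cases
    case 1
    have "energy (- \<delta>) r l \<le> (l - r) * (cmod (u r))\<^sup>2"
      using 1 assms half by (intro half_cell_lower) auto
    also have "\<dots> \<le> (r' - r) / 2 * (cmod (u r))\<^sup>2"
      using 1 half by (intro mult_right_mono) auto
    also have "\<dots> \<le> (r' - r) / 2 * ((cmod (u r))\<^sup>2 + (cmod (u r'))\<^sup>2)"
      using assms by (intro mult_left_mono) auto
    finally show ?thesis
      using gap_lower[of l l' \<delta>] energy_combine[of r l l' "- \<delta>"] assms by simp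
  next
    case 2
    have "energy (- \<delta>) r' l' \<le> (l' - r') * (cmod (u l'))\<^sup>2"
      using 2 assms half by (intro half_cell_lower_right) auto
    also have "\<dots> \<le> (l' - l) / 2 * (cmod (u l'))\<^sup>2"
      using 2 half by (intro mult_right_mono) auto
    also have "\<dots> \<le> (l' - l) / 2 * ((cmod (u l))\<^sup>2 + (cmod (u l'))\<^sup>2)"
      using assms by (intro mult_left_mono) auto
    finally show ?thesis
      using gap_lower[of r r' \<delta>] energy_combine[of r r' l' "- \<delta>"] assms by simp
  next
    case 3
    \<comment> \<open>A node \<open>s\<close> between \<open>l\<close> and \<open>r'\<close> is
      within half a gap of either midpoint, so the inner half weights of both gaps together pay for
      \<open>[m, m']\<close>.\<close>
    have one: "energy (- \<delta>) m m' \<le> ((r' - r) / 2 + (l' - l) / 2) * (cmod (u s))\<^sup>2"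
      if s: "l \<le> s" "s \<le> r'" for s
    proof -
      have "energy (- \<delta>) m s \<le> (s - m) * (cmod (u s))\<^sup>2"
        using s 3 half assms by (intro half_cell_lower_right) auto
      moreover have "energy (- \<delta>) s m' \<le> (m' - s) * (cmod (u s))\<^sup>2"
        using s 3 half assms by (intro half_cell_lower) auto
      moreover have "(m' - s) * (cmod (u s))\<^sup>2 + (s - m) * (cmod (u s))\<^sup>2
          \<le> ((r' - r) / 2 + (l' - l) / 2) * (cmod (u s))\<^sup>2"
        unfolding distrib_right[symmetric] using s half by (intro mult_right_mono zero_le_power2) linarith
      ultimately show ?thesis
        using energy_combine[of m s m' "- \<delta>"] s 3 by linarith
    qed
    have "energy (- \<delta>) m m' \<le> (r' - r) / 2 * (cmod (u r'))\<^sup>2 + (l' - l) / 2 * (cmod (u l))\<^sup>2"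
    proof (cases "(cmod (u l))\<^sup>2 \<le> (cmod (u r'))\<^sup>2")
      case True
      then have "(r' - r) / 2 * (cmod (u l))\<^sup>2 \<le> (r' - r) / 2 * (cmod (u r'))\<^sup>2"
        using assms by (intro mult_left_mono) auto
      with one[of l] assms show ?thesis unfolding distrib_right by linarith
    next
      case False
      then have "(l' - l) / 2 * (cmod (u r'))\<^sup>2 \<le> (l' - l) / 2 * (cmod (u l))\<^sup>2"
        using assms by (intro mult_left_mono) auto
      with one[of r'] assms show ?thesis unfolding distrib_right by linarith
    qed
    moreover have "energy (- \<delta>) r m \<le> (r' - r) / 2 * (cmod (u r))\<^sup>2"
      using half_cell_lower[of r m \<delta>] le half assms by auto
    moreover have "energy (- \<delta>) m' l' \<le> (l' - l) / 2 * (cmod (u l'))\<^sup>2"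
      using half_cell_lower_right[of m' l' \<delta>] le half assms by auto
    moreover have "energy (- \<delta>) r l' = energy (- \<delta>) r m + energy (- \<delta>) m m' + energy (- \<delta>) m' l'"
      using energy_combine[of r m l' "- \<delta>"] energy_combine[of m m' l' "- \<delta>"] le by simp
    ultimately show ?thesis unfolding distrib_left by linarith
  qed
qed

end

section \<open>Sampling schemes\<close>

text \<open>Each weight is half the sum of the two adjacent gaps; regrouping by gaps gives the
  trapezoidal rule plus half a gap beyond each end.\<close>

lemma sum_trapezoid:
  fixes X a :: "nat \<Rightarrow> real"
  assumes "1 \<le> p" "p \<le> q"
  shows "(\<Sum>n=p..q. (X (n + 1) - X (n - 1)) / 2 * a n) =
    (X p - X (p - 1)) / 2 * a p + (\<Sum>n=p..<q. (X (n + 1) - X n) / 2 * (a n + a (n + 1)))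
      + (X (q + 1) - X q) / 2 * a q"
  using assms(2)
proof (induction q rule: dec_induct)
  case base
  show ?case by (simp add: field_simps)
next
  case (step q)
  have "{p..Suc q} = insert (Suc q) {p..q}" "{p..<Suc q} = insert q {p..<q}" using step by auto
  then show ?case using step by (simp add: field_simps)
qed

context C1_curve begin

text \<open>The order of the end nodes is carried through the induction because energies add up only
  over ordered points.\<close>

lemma chain_lower:
  fixes X :: "nat \<Rightarrow> real"
  assumes "p \<le> q" "\<And>n. p \<le> n \<Longrightarrow> n < q \<Longrightarrow> X n \<le> X (n + 1) \<and> X (n + 1) - X n \<le> \<delta>" "0 < \<delta>" "\<delta> < 1"
  shows "X p \<le> X q \<and> energy (- \<delta>) (X p) (X q) \<le>
    (\<Sum>n=p..<q. (X (n + 1) - X n) / 2 * ((cmod (u (X n)))\<^sup>2 + (cmod (u (X (n + 1))))\<^sup>2))"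
  using assms(1,2)
proof (induction q rule: dec_induct)
  case base
  show ?case by (simp add: energy_def)
next
  case (step q)
  have s: "X q \<le> X (Suc q)" "X (Suc q) - X q \<le> \<delta>" using step.prems[of q] step.hyps by auto
  have IH: "X p \<le> X q" "energy (- \<delta>) (X p) (X q) \<le>
    (\<Sum>n=p..<q. (X (n + 1) - X n) / 2 * ((cmod (u (X n)))\<^sup>2 + (cmod (u (X (n + 1))))\<^sup>2))"
    using step by auto
  have "{p..<Suc q} = insert q {p..<q}" using step by auto
  with IH s gap_lower[OF s assms(3,4)] energy_combine[OF IH(1) s(1), of "- \<delta>"]
  show ?case by simp
qed

lemma chain_upper:
  fixes X :: "nat \<Rightarrow> real"
  assumes "p \<le> q" "\<And>n. p \<le> n \<Longrightarrow> n < q \<Longrightarrow> X n \<le> X (n + 1) \<and> X (n + 1) - X n \<le> \<delta>" "0 < \<delta>"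
  shows "X p \<le> X q \<and> (\<Sum>n=p..<q. (X (n + 1) - X n) / 2 * ((cmod (u (X n)))\<^sup>2 + (cmod (u (X (n + 1))))\<^sup>2))
    \<le> energy \<delta> (X p) (X q)"
  using assms(1,2)
proof (induction q rule: dec_induct)
  case base
  show ?case by (simp add: energy_def)
next
  case (step q)
  have s: "X q \<le> X (Suc q)" "X (Suc q) - X q \<le> \<delta>" using step.prems[of q] step.hyps by auto
  have IH: "X p \<le> X q" "(\<Sum>n=p..<q. (X (n + 1) - X n) / 2 * ((cmod (u (X n)))\<^sup>2 + (cmod (u (X (n + 1))))\<^sup>2))
    \<le> energy \<delta> (X p) (X q)"
    using step by auto
  have "{p..<Suc q} = insert q {p..<q}" using step by auto
  with IH s gap_upper[OF s assms(3)] energy_combine[OF IH(1) s(1), of "\<delta>"]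
  show ?case by simp
qed

end

section \<open>Order and spacing of the nodes\<close>

locale sampling_scheme =
  fixes K \<delta> :: real and N :: nat and w :: "nat \<Rightarrow> real"
  assumes dense: "KD_dense K \<delta> N w"
begin

abbreviation X :: "nat \<Rightarrow> real" where "X \<equiv> omega_ext K N w"
abbreviation \<mu> :: "nat \<Rightarrow> real" where "\<mu> \<equiv> mu_weight K N w"

lemma \<delta>_pos: "0 < \<delta>" and \<delta>_less_1: "\<delta> < 1" and N_pos: "1 \<le> N"
  using dense by (auto simp: KD_dense_def)

lemma X_0: "X 0 = X N - 2 * K" and X_Suc_N: "X (N + 1) = X 1 + 2 * K"
  using N_pos by (auto simp: omega_ext_def)

lemma X_eq: "n \<in> {1..N} \<Longrightarrow> X n = w n"
  by (auto simp: omega_ext_def)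

lemma X_bounds: "n \<in> {1..N} \<Longrightarrow> - K \<le> X n \<and> X n \<le> K"
  using dense X_eq by (auto simp: KD_dense_def)

lemma X_gap: "n \<le> N \<Longrightarrow> X (n + 1) - X n \<le> \<delta>"
  using dense by (auto simp: KD_dense_def)

text \<open>The inequality is weak because of the artificial nodes: if \<open>- K\<close> and
  \<open>K\<close> are both sampled, then \<open>X 0 = X 1\<close>.\<close>

lemma X_step: "n \<le> N \<Longrightarrow> X n \<le> X (n + 1)"
proof -
  assume n: "n \<le> N"
  consider "n = 0" | "n = N" | "1 \<le> n" "n < N" using n by linarith
  then show ?thesis
  proof cases
    case 1 then show ?thesis using X_0 X_bounds[of 1] X_bounds[of N] N_pos by simp
  next
    case 2 then show ?thesis using X_Suc_N X_bounds[of 1] X_bounds[of N] N_pos by simp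
  next
    case 3
    then have "w n < w (n + 1)"
      using dense by (auto simp: KD_dense_def strict_mono_on_def)
    then show ?thesis using 3 X_eq[of n] X_eq[of "n + 1"] by simp
  qed
qed

lemma X_mono: "m \<le> n \<Longrightarrow> n \<le> N + 1 \<Longrightarrow> X m \<le> X n"
  by (induction n rule: dec_induct) (use X_step in \<open>fastforce+\<close>)

lemma X_near_ends: "X 1 \<le> - K + \<delta>" "K - \<delta> \<le> X N"
  using X_gap[of 0] X_0 X_bounds[of 1] X_bounds[of N] N_pos by auto

lemma \<mu>_eq: "\<mu> n = (X (n + 1) - X (n - 1)) / 2"
  by (simp add: mu_weight_def)

lemma \<mu>_nonneg: "n \<in> {1..N} \<Longrightarrow> 0 \<le> \<mu> n"
  using X_mono[of "n - 1" "n + 1"] by (auto simp: \<mu>_eq)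

lemma last_node:
  assumes "X 1 \<le> z" "z < X N"
  obtains p where "1 \<le> p" "p < N" "X p \<le> z" "z < X (p + 1)"
proof -
  define p where "p = (GREATEST n. n \<le> N \<and> 1 \<le> n \<and> X n \<le> z)"
  have p: "p \<le> N \<and> 1 \<le> p \<and> X p \<le> z"
    unfolding p_def by (rule GreatestI_nat[where k = 1 and b = N]) (use assms N_pos in auto)
  then have "p < N" using assms by (metis le_neq_implies_less not_le)
  moreover have "z < X (p + 1)"
  proof (rule ccontr)
    assume "\<not> ?thesis"
    then have "p + 1 \<le> p"
      using \<open>p < N\<close> by (subst (2) p_def, intro Greatest_le_nat[where b = N]) auto
    then show False by simp
  qed
  ultimately show ?thesis using p that by blast
qed

text \<open>The tie is resolved the other way than in \<open>last_node\<close>: a node equal to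
  \<open>z\<close> becomes the right end of the gap.\<close>

lemma last_node_strict:
  assumes "X 1 < z" "z \<le> X N"
  obtains p where "1 \<le> p" "p < N" "X p < z" "z \<le> X (p + 1)"
proof -
  define p where "p = (GREATEST n. n \<le> N \<and> 1 \<le> n \<and> X n < z)"
  have p: "p \<le> N \<and> 1 \<le> p \<and> X p < z"
    unfolding p_def by (rule GreatestI_nat[where k = 1 and b = N]) (use assms N_pos in auto)
  then have "p < N" using assms by (metis le_neq_implies_less not_le)
  moreover have "z \<le> X (p + 1)"
  proof (rule ccontr)
    assume "\<not> ?thesis"
    then have "p + 1 \<le> p"
      using \<open>p < N\<close> by (subst (2) p_def, intro Greatest_le_nat[where b = N]) auto
    then show False by simp
  qed
  ultimately show ?thesis using p that by blast
qed

end

section \<open>Weighted sums of squared samples\<close>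

locale sampled_curve = sampling_scheme + C1_curve
begin

lemma sum_\<mu>:
  assumes "1 \<le> p" "p \<le> q"
  shows "(\<Sum>n=p..q. \<mu> n * (cmod (u (X n)))\<^sup>2) =
    (X p - X (p - 1)) / 2 * (cmod (u (X p)))\<^sup>2
      + (\<Sum>n=p..<q. (X (n + 1) - X n) / 2 * ((cmod (u (X n)))\<^sup>2 + (cmod (u (X (n + 1))))\<^sup>2))
      + (X (q + 1) - X q) / 2 * (cmod (u (X q)))\<^sup>2"
  using sum_trapezoid[OF assms, of X "\<lambda>n. (cmod (u (X n)))\<^sup>2"] by (simp add: \<mu>_eq)

text \<open>The half gaps beyond both ends are retained to pay for the piece that closes a period or
  reaches a zero of the curve.\<close>

lemma nodes_lower:
  assumes "1 \<le> p" "p \<le> q" "q \<le> N"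
  shows "(X p - X (p - 1)) / 2 * (cmod (u (X p)))\<^sup>2 + energy (- \<delta>) (X p) (X q)
      + (X (q + 1) - X q) / 2 * (cmod (u (X q)))\<^sup>2 \<le> (\<Sum>n=p..q. \<mu> n * (cmod (u (X n)))\<^sup>2)"
proof -
  have "energy (- \<delta>) (X p) (X q) \<le> (\<Sum>n=p..<q. (X (n + 1) - X n) / 2 * ((cmod (u (X n)))\<^sup>2 + (cmod (u (X (n + 1))))\<^sup>2))"
    using chain_lower[of p q X \<delta>] X_step X_gap \<delta>_pos \<delta>_less_1 assms by force
  then show ?thesis unfolding sum_\<mu>[OF assms(1,2)] by simp
qed

lemma nodes_upper:
  "(\<Sum>n=1..N. \<mu> n * (cmod (u (X n)))\<^sup>2) \<le> energy \<delta> ((X 0 + X 1) / 2) ((X N + X (N + 1)) / 2)"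
proof -
  let ?a = "(X 0 + X 1) / 2" and ?b = "(X N + X (N + 1)) / 2"
  have h: "X 1 - ?a = (X 1 - X 0) / 2" "?b - X N = (X (N + 1) - X N) / 2" by (simp_all add: field_simps)
  have le: "X 0 \<le> X 1" "X N \<le> X (N + 1)" "X 1 \<le> X N" using X_mono N_pos by auto
  have gaps: "X 1 - X 0 \<le> \<delta>" "X (N + 1) - X N \<le> \<delta>" using X_gap[of 0] X_gap[of N] by auto
  have "(\<Sum>n=1..<N. (X (n + 1) - X n) / 2 * ((cmod (u (X n)))\<^sup>2 + (cmod (u (X (n + 1))))\<^sup>2)) \<le> energy \<delta> (X 1) (X N)"
    using chain_upper[of 1 N X \<delta>] X_step X_gap \<delta>_pos N_pos by force
  moreover have "(X 1 - X 0) / 2 * (cmod (u (X 1)))\<^sup>2 \<le> energy \<delta> ?a (X 1)"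
    using half_cell_upper_right[of ?a "X 1" \<delta>] le gaps \<delta>_pos unfolding h by simp
  moreover have "(X (N + 1) - X N) / 2 * (cmod (u (X N)))\<^sup>2 \<le> energy \<delta> (X N) ?b"
    using half_cell_upper[of "X N" ?b \<delta>] le gaps \<delta>_pos unfolding h by simp
  moreover have "energy \<delta> ?a ?b = energy \<delta> ?a (X 1) + energy \<delta> (X 1) (X N) + energy \<delta> (X N) ?b"
    using energy_combine[of ?a "X 1" ?b \<delta>] energy_combine[of "X 1" "X N" ?b \<delta>] le by simp
  ultimately show ?thesis using sum_\<mu>[of 1 N] N_pos by simp
qed

lemma subsum_\<mu>:
  assumes "A \<subseteq> {1..N}" "B \<subseteq> A"
  shows "(\<Sum>n\<in>B. \<mu> n * (cmod (u (X n)))\<^sup>2) \<le> (\<Sum>n\<in>A. \<mu> n * (cmod (u (X n)))\<^sup>2)"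
  using assms \<mu>_nonneg by (intro sum_mono2) (auto intro: finite_subset)

text \<open>The closing gap from \<open>X N\<close> to \<open>X 1 + P\<close> is no longer than the
  cyclic gap of the scheme since \<open>P \<le> 2 * K\<close>, so the outer half weights of the
  first and last node cover it.\<close>

lemma lower_all_nodes:
  assumes per: "\<And>t. cmod (u (t + P)) = cmod (u t)" and P: "P \<le> 2 * K" and wrap: "X N \<le> X 1 + P"
  shows "energy (- \<delta>) (X 1) (X 1 + P) \<le> (\<Sum>n=1..N. \<mu> n * (cmod (u (X n)))\<^sup>2)"
proof -
  let ?g = "X 1 + P - X N"
  have g: "?g \<le> X 1 - X 0" "?g \<le> X (N + 1) - X N" "?g \<le> \<delta>"
    using X_0 X_Suc_N P X_gap[of N] by auto
  have "energy (- \<delta>) (X N) (X 1 + P) \<le> ?g / 2 * (cmod (u (X N)))\<^sup>2 + ?g / 2 * (cmod (u (X 1)))\<^sup>2"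
    using gap_lower[OF wrap g(3) \<delta>_pos \<delta>_less_1] unfolding per distrib_left .
  also have "\<dots> \<le> (X (N + 1) - X N) / 2 * (cmod (u (X N)))\<^sup>2 + (X 1 - X 0) / 2 * (cmod (u (X 1)))\<^sup>2"
    using g by (intro add_mono mult_right_mono) auto
  finally show ?thesis
    using nodes_lower[of 1 N] N_pos energy_combine[of "X 1" "X N" "X 1 + P" "- \<delta>"] X_mono[of 1 N] wrap by simp
qed

text \<open>By periodicity, the gap after \<open>p\<close> shifted by \<open>P\<close> carries the
  same samples. It overlaps the gap after \<open>q\<close> from the right, and the crossing estimate
  closes the period there without counting energy twice.\<close>

lemma lower_crossing:
  assumes per: "\<And>t. cmod (u (t + P)) = cmod (u t)"
    and pq: "1 \<le> p" "p + 1 \<le> q" "q < N"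
    and cross: "X q \<le> X p + P" "X p + P \<le> X (q + 1)" "X (q + 1) \<le> X (p + 1) + P"
  shows "energy (- \<delta>) (X (p + 1)) (X (p + 1) + P) \<le> (\<Sum>n=p..q + 1. \<mu> n * (cmod (u (X n)))\<^sup>2)"
proof -
  let ?T = "\<lambda>n. (X (n + 1) - X n) / 2 * ((cmod (u (X n)))\<^sup>2 + (cmod (u (X (n + 1))))\<^sup>2)"
  have "energy (- \<delta>) (X q) (X (p + 1) + P) \<le> ?T q + ?T p"
    using crossing_gaps_lower[of "X q" "X p + P" "X (q + 1)" "X (p + 1) + P" \<delta>] cross pq
      X_gap[of p] X_gap[of q] \<delta>_pos \<delta>_less_1 unfolding per by simp
  moreover have ch: "X (p + 1) \<le> X q \<and> energy (- \<delta>) (X (p + 1)) (X q) \<le> (\<Sum>n=p + 1..<q. ?T n)"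
    using pq X_step X_gap \<delta>_pos \<delta>_less_1 by (intro chain_lower) auto
  moreover have "(\<Sum>n=p..<q + 1. ?T n) = ?T p + (\<Sum>n=p + 1..<q. ?T n) + ?T q"
    using pq by (simp add: sum.atLeast_Suc_lessThan)
  moreover have "energy (- \<delta>) (X (p + 1)) (X (p + 1) + P) = energy (- \<delta>) (X (p + 1)) (X q) + energy (- \<delta>) (X q) (X (p + 1) + P)"
    using ch cross by (intro energy_combine) auto
  moreover have "0 \<le> (X p - X (p - 1)) / 2 * (cmod (u (X p)))\<^sup>2"
    "0 \<le> (X (q + 1 + 1) - X (q + 1)) / 2 * (cmod (u (X (q + 1))))\<^sup>2"
    using X_mono[of "p - 1" p] X_mono[of "q + 1" "q + 1 + 1"] pq by auto
  ultimately show ?thesis using pq sum_\<mu>[of p "q + 1"] by linarith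
qed

text \<open>If the nodes span more than one period, they must be glued along a seam modulo \<open>P\<close>. Near the seam
  the nodes \<open>X n + P / 2\<close> and \<open>X n - P / 2\<close> interleave, and one looks, within distance \<open>\<delta>\<close> of \<open>0\<close>, for
  a gap of the former kind that overlaps a gap of the latter kind from the right. The point \<open>z\<close> is \<open>0\<close>
  moved to where actual nodes (and not only the artificial ones with index \<open>0\<close> and \<open>N + 1\<close>) exist.\<close>

lemma lower_near_period:
  assumes per: "\<And>t. cmod (u (t + P)) = cmod (u t)" and P: "2 \<le> P" "P \<le> 2 * K"
  shows "\<exists>\<alpha>. energy (- \<delta>) \<alpha> (\<alpha> + P) \<le> (\<Sum>n | n \<in> {1..N} \<and> \<bar>X n\<bar> \<le> P / 2 + \<delta>. \<mu> n * (cmod (u (X n)))\<^sup>2)"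
    (is "\<exists>\<alpha>. _ \<le> sum _ ?A")
proof (cases "X N \<le> X 1 + P")
  case True
  \<comment> \<open>The end nodes are within \<delta> of \<open>- K\<close> and \<open>K\<close>,
    and \<open>P / 2 \<le> K\<close>; a span of at most \<open>P\<close> therefore keeps every node
    within \<open>P / 2 + \<delta>\<close>.\<close>
  have "{1..N} \<subseteq> ?A"
  proof
    fix n assume n: "n \<in> {1..N}"
    then have "X 1 \<le> X n" "X n \<le> X N" using X_mono by auto
    moreover have "X 1 - X N + 2 * K \<le> \<delta>" using X_gap[of 0] X_0 by simp
    ultimately show "n \<in> ?A" using n True X_bounds[of 1] X_bounds[of N] N_pos P by (auto simp: abs_le_iff)
  qed
  then have "(\<Sum>n=1..N. \<mu> n * (cmod (u (X n)))\<^sup>2) \<le> (\<Sum>n\<in>?A. \<mu> n * (cmod (u (X n)))\<^sup>2)"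
    by (intro subsum_\<mu>) auto
  with lower_all_nodes[OF per P(2) True] show ?thesis by (intro exI[of _ "X 1"]) (rule order_trans)
next
  case False
  define z where "z = max (X 1 + P / 2) (min 0 (X N - P / 2))"
  have ends: "X 1 \<le> - K + \<delta>" "K - \<delta> \<le> X N" "- K \<le> X 1" "X N \<le> K"
    using X_near_ends X_bounds N_pos by auto
  have gap: "X 1 - X N + 2 * K \<le> \<delta>" using X_gap[of 0] X_0 by simp
  have zN: "z \<le> X N - P / 2"
    using False P by (auto simp: z_def max_def min_def)
  then have "X 1 \<le> z - P / 2" "z - P / 2 < X N"
    using P by (auto simp: z_def)
  then obtain p where p: "1 \<le> p" "p < N" "X p \<le> z - P / 2" "z - P / 2 < X (p + 1)"
    by (rule last_node)
  have pz: "z - P / 2 - \<delta> < X p" using p X_gap[of p] by simp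
  have X1p: "X 1 \<le> X p" using X_mono p by auto
  have "X 1 < X p + P" "X p + P \<le> X N" using X1p p P zN by auto
  then obtain q where q: "1 \<le> q" "q < N" "X q < X p + P" "X p + P \<le> X (q + 1)"
    by (rule last_node_strict)
  have qN: "X (q + 1) \<le> X N" using X_mono q by auto
  have "X 1 \<le> X (q + 1) - P" "X (q + 1) - P < X N" using qN q X1p P by auto
  \<comment> \<open>The gap after \<open>p\<close>, shifted by \<open>P\<close>, may end before
    \<open>X (q + 1)\<close>. Advancing to the last node at or below \<open>X (q + 1) - P\<close>
    makes the shifted gap extend beyond it.\<close>
  then obtain p' where p': "1 \<le> p'" "p' < N" "X p' \<le> X (q + 1) - P" "X (q + 1) - P < X (p' + 1)"
    by (rule last_node)
  have pp': "X p \<le> X p'"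
  proof (rule ccontr)
    assume "\<not> ?thesis"
    then have "p' + 1 \<le> p" using X_mono[of p p'] p' by force
    then have "X (p' + 1) \<le> X p" using X_mono[of "p' + 1" p] p by simp
    then show False using p' q by linarith
  qed
  \<comment> \<open>A period is longer than any gap.\<close>
  have "p' + 1 \<le> q"
  proof (rule ccontr)
    assume "\<not> ?thesis"
    then have "X q \<le> X p'" using X_mono[of q p'] p' by simp
    then show False using p' X_gap[of q] q P \<delta>_less_1 by simp
  qed
  have "energy (- \<delta>) (X (p' + 1)) (X (p' + 1) + P) \<le> (\<Sum>n=p'..q + 1. \<mu> n * (cmod (u (X n)))\<^sup>2)"
    using p' q pp' \<open>p' + 1 \<le> q\<close> by (intro lower_crossing per) auto
  also have "\<dots> \<le> (\<Sum>n\<in>?A. \<mu> n * (cmod (u (X n)))\<^sup>2)"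
  proof (intro subsum_\<mu> subsetI)
    fix n assume n: "n \<in> {p'..q + 1}"
    have "X p' \<le> X n" "X n \<le> X (q + 1)" using n X_mono q by auto
    \<comment> \<open>A negative \<open>z\<close> means that the nodes end before
      \<open>P / 2\<close>. This forces \<open>K < P / 2 + \<delta>\<close>, so no node is too far
      left; the mirror argument bounds \<open>X (q + 1)\<close> for positive
      \<open>z\<close>.\<close>
    moreover have "- P / 2 - \<delta> \<le> X p'"
    proof (cases "0 \<le> z")
      case True
      then show ?thesis using pz pp' by simp
    next
      case False
      then show ?thesis using X1p pp' ends gap by (auto simp: z_def max_def min_def split: if_splits)
    qed
    moreover have "X (q + 1) \<le> P / 2 + \<delta>"
    proof (cases "z \<le> 0")
      case True
      then show ?thesis using X_gap[of q] q p by simp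
    next
      case False
      then show ?thesis using qN ends gap by (auto simp: z_def max_def min_def split: if_splits)
    qed
    ultimately show "n \<in> ?A" using n p' q by auto
  qed auto
  finally show ?thesis ..
qed

text \<open>The zeros at \<open>- R\<close> and \<open>R\<close> act as extra nodes of value 0. Each
  cuts a gap of the scheme short, and the weight of the neighbouring inner node covers what is left
  of it.\<close>

lemma lower_zeros:
  assumes zero: "u (- R) = 0" "u R = 0" and R: "1 / 2 \<le> R" "R \<le> K"
  shows "energy (- \<delta>) (- R) R \<le> (\<Sum>n | n \<in> {1..N} \<and> \<bar>X n\<bar> \<le> R. \<mu> n * (cmod (u (X n)))\<^sup>2)"
    (is "_ \<le> sum _ ?A")
proof -
  define p where "p = (LEAST n. 1 \<le> n \<and> - R \<le> X n)"
  define q where "q = (GREATEST n. n \<le> N \<and> X n \<le> R)"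
  have XN: "- R \<le> X N" "X 1 \<le> R" using X_near_ends R \<delta>_less_1 by auto
  have p: "1 \<le> p \<and> - R \<le> X p" "p \<le> N"
    unfolding p_def using XN N_pos by (auto intro: LeastI2[of _ N] Least_le)
  have q: "q \<le> N \<and> X q \<le> R" "1 \<le> q"
    unfolding q_def using XN N_pos
    by (auto intro!: GreatestI_nat[where k = 1 and b = N and P = "\<lambda>n. n \<le> N \<and> X n \<le> R"] Greatest_le_nat[where b = N])
  \<comment> \<open>For \<open>p = 1\<close> the predecessor is the artificial node, and
    \<open>X 0 \<le> - K\<close>.\<close>
  have p1: "X (p - 1) \<le> - R"
  proof (cases "p = 1")
    case True
    then show ?thesis using X_0 X_bounds[of N] N_pos R by simp
  next
    case False
    then show ?thesis
      using not_less_Least[of "p - 1" "\<lambda>n. 1 \<le> n \<and> - R \<le> X n", folded p_def] p by auto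
  qed
  have q1: "R \<le> X (q + 1)"
  proof (cases "q = N")
    case True
    then show ?thesis using X_Suc_N X_bounds[of 1] N_pos R by simp
  next
    case False
    show ?thesis
    proof (rule ccontr)
      assume "\<not> ?thesis"
      then have "q + 1 \<le> q"
        using False q by (subst (2) q_def, intro Greatest_le_nat[where b = N]) auto
      then show False by simp
    qed
  qed
  have gaps: "X p - X (p - 1) \<le> \<delta>" "X (q + 1) - X q \<le> \<delta>"
    using X_gap[of "p - 1"] X_gap[of q] p q by auto
  \<comment> \<open>Otherwise a single gap would bridge \<open>[-R, R]\<close>, whose length is at
    least 1 and hence exceeds \<delta>.\<close>
  have pq: "p \<le> q"
  proof (rule ccontr)
    assume "\<not> ?thesis"
    then have "X (q + 1) \<le> X p" using X_mono[of "q + 1" p] p by simp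
    then show False using p1 q1 gaps R \<delta>_less_1 by simp
  qed
  then have Xpq: "X p \<le> X q" using X_mono q by simp
  have "energy (- \<delta>) (- R) (X p) \<le> (X p + R) / 2 * (cmod (u (X p)))\<^sup>2"
    using gap_lower[of "- R" "X p" \<delta>] p p1 gaps zero \<delta>_pos \<delta>_less_1 by simp
  also have "\<dots> \<le> (X p - X (p - 1)) / 2 * (cmod (u (X p)))\<^sup>2"
    using p1 by (intro mult_right_mono divide_right_mono diff_left_mono[of _ "- R", simplified] zero_le_power2) simp_all
  finally have L: "energy (- \<delta>) (- R) (X p) \<le> (X p - X (p - 1)) / 2 * (cmod (u (X p)))\<^sup>2" .
  have "energy (- \<delta>) (X q) R \<le> (R - X q) / 2 * (cmod (u (X q)))\<^sup>2"
    using gap_lower[of "X q" R \<delta>] q q1 gaps zero \<delta>_pos \<delta>_less_1 by simp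
  also have "\<dots> \<le> (X (q + 1) - X q) / 2 * (cmod (u (X q)))\<^sup>2"
    using q1 by (intro mult_right_mono divide_right_mono diff_right_mono zero_le_power2) simp_all
  finally have "energy (- \<delta>) (X q) R \<le> (X (q + 1) - X q) / 2 * (cmod (u (X q)))\<^sup>2" .
  with L have "energy (- \<delta>) (- R) R \<le> (\<Sum>n=p..q. \<mu> n * (cmod (u (X n)))\<^sup>2)"
    using nodes_lower[of p q] p q pq Xpq
      energy_combine[of "- R" "X p" R "- \<delta>"] energy_combine[of "X p" "X q" R "- \<delta>"] by simp
  also have "\<dots> \<le> (\<Sum>n\<in>?A. \<mu> n * (cmod (u (X n)))\<^sup>2)"
  proof (intro subsum_\<mu> subsetI)
    fix n assume n: "n \<in> {p..q}"
    then have "X p \<le> X n" "X n \<le> X q" using X_mono q by auto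
    then show "n \<in> ?A" using n p q by (auto simp: abs_le_iff)
  qed auto
  finally show ?thesis .
qed

end

section \<open>Trigonometric polynomials and the sinc function\<close>

text \<open>Frequencies are arbitrary reals: the applications use translated integers, symmetric
  cell frequencies, and cell frequencies split by the cosine window.\<close>

definition trig_poly :: "'i set \<Rightarrow> ('i \<Rightarrow> complex) \<Rightarrow> ('i \<Rightarrow> real) \<Rightarrow> real \<Rightarrow> complex" where
  "trig_poly A c \<nu> t = (\<Sum>j\<in>A. c j * cis (2 * pi * \<nu> j * t))"

lemma has_vector_derivative_cis_linear:
  "((\<lambda>t. cis (s * t)) has_vector_derivative \<i> * s * cis (s * t)) (at t within S)"
  using exp_scaleR_has_vector_derivative_right[of "\<i> * complex_of_real s" t S]
  by (simp add: cis_conv_exp scaleR_conv_of_real mult_ac)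

lemma trig_poly_C1:
  "C1_curve (trig_poly A c \<nu>) (trig_poly A (\<lambda>j. c j * (\<i> * (2 * pi * \<nu> j))) \<nu>)"
proof
  fix t
  have "((\<lambda>t. \<Sum>j\<in>A. c j * cis ((2 * pi * \<nu> j) * t)) has_vector_derivative
      (\<Sum>j\<in>A. c j * (\<i> * (2 * pi * \<nu> j) * cis (2 * pi * \<nu> j * t)))) (at t)"
    by (intro has_vector_derivative_sum has_vector_derivative_mult_right has_vector_derivative_cis_linear)
  then show "(trig_poly A c \<nu> has_vector_derivative trig_poly A (\<lambda>j. c j * (\<i> * (2 * pi * \<nu> j))) \<nu> t) (at t)"
    unfolding trig_poly_def by (simp add: mult.assoc)
next
  show "continuous_on UNIV (trig_poly A (\<lambda>j. c j * (\<i> * (2 * pi * \<nu> j))) \<nu>)"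
    unfolding trig_poly_def by (intro continuous_intros)
qed

lemma has_integral_cis_period:
  assumes "L \<ge> 0" "s * L = 2 * pi * of_int n" "n \<noteq> 0"
  shows "((\<lambda>t. cis (s * t)) has_integral 0) {\<alpha>..\<alpha> + L}"
proof -
  have s: "s \<noteq> 0" using assms by auto
  have "((\<lambda>t. cis (s * t)) has_integral cis (s * (\<alpha> + L)) / (\<i> * s) - cis (s * \<alpha>) / (\<i> * s)) {\<alpha>..\<alpha> + L}"
  proof (rule fundamental_theorem_of_calculus)
    fix t
    have "((\<lambda>t. cis (s * t) / (\<i> * s)) has_vector_derivative (\<i> * s * cis (s * t)) / (\<i> * s)) (at t within {\<alpha>..\<alpha> + L})"
      by (intro has_vector_derivative_divide has_vector_derivative_cis_linear)
    then show "((\<lambda>t. cis (s * t) / (\<i> * s)) has_vector_derivative cis (s * t)) (at t within {\<alpha>..\<alpha> + L})"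
      using s by simp
  qed (use assms in auto)
  moreover have "cis (s * (\<alpha> + L)) = cis (s * \<alpha>)"
    by (simp add: distrib_left assms(2) cis_mult[symmetric])
  ultimately show ?thesis by simp
qed

text \<open>Orthogonality depends only on frequency differences, so the polynomial may be periodic
  merely up to a phase. The starting point is free because the seam between periods is dictated by
  the nodes.\<close>

lemma integral_norm_sq_trig_poly:
  assumes fin: "finite A" and L: "(L :: real) \<ge> 0"
    and sep: "\<And>j k. j \<in> A \<Longrightarrow> k \<in> A \<Longrightarrow> j \<noteq> k \<Longrightarrow> \<exists>n::int. n \<noteq> 0 \<and> (\<nu> j - \<nu> k) * L = n"
  shows "integral {\<alpha>..\<alpha> + L} (\<lambda>t. (cmod (trig_poly A c \<nu> t))\<^sup>2) = L * (\<Sum>j\<in>A. (cmod (c j))\<^sup>2)"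
proof -
  have cis_diff: "cis (2 * pi * (x - y) * t) = cis (2 * pi * x * t) * cnj (cis (2 * pi * y * t))" for x y t
    by (simp add: cis_cnj cis_mult algebra_simps)
  have "((\<lambda>t. \<Sum>j\<in>A. \<Sum>k\<in>A. (c j * cnj (c k)) * cis (2 * pi * (\<nu> j - \<nu> k) * t)) has_integral
      (\<Sum>j\<in>A. \<Sum>k\<in>A. (c j * cnj (c k)) * (if j = k then complex_of_real L else 0))) {\<alpha>..\<alpha> + L}"
  proof (intro has_integral_sum fin has_integral_mult_right)
    fix j k assume jk: "j \<in> A" "k \<in> A"
    show "((\<lambda>t. cis (2 * pi * (\<nu> j - \<nu> k) * t)) has_integral (if j = k then complex_of_real L else 0)) {\<alpha>..\<alpha> + L}"
    proof (cases "j = k")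
      case True
      have "((\<lambda>t. 1 :: complex) has_integral complex_of_real L) {\<alpha>..\<alpha> + L}"
        using has_integral_const_real[of "1 :: complex" \<alpha> "\<alpha> + L"] L
        by (simp add: scaleR_conv_of_real)
      moreover have "cis (2 * pi * (\<nu> j - \<nu> k) * t) = 1" for t using True by simp
      ultimately show ?thesis using True by simp
    next
      case False
      from sep[OF jk False] obtain n :: int where "n \<noteq> 0" "(\<nu> j - \<nu> k) * L = n" by auto
      then show ?thesis
        using has_integral_cis_period[OF L, of "2 * pi * (\<nu> j - \<nu> k)" n] False by (simp add: mult.assoc)
    qed
  qed
  moreover have "(\<Sum>j\<in>A. \<Sum>k\<in>A. (c j * cnj (c k)) * cis (2 * pi * (\<nu> j - \<nu> k) * t))
      = complex_of_real ((cmod (trig_poly A c \<nu> t))\<^sup>2)" for t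
    unfolding complex_norm_square trig_poly_def cnj_sum sum_product
    by (intro sum.cong refl) (simp add: cis_diff)
  moreover have "(\<Sum>j\<in>A. \<Sum>k\<in>A. (c j * cnj (c k)) * (if j = k then complex_of_real L else 0))
      = complex_of_real (L * (\<Sum>j\<in>A. (cmod (c j))\<^sup>2))"
    using fin by (simp add: if_distrib[of "\<lambda>x. _ * x"] sum.delta complex_norm_square[symmetric] sum_distrib_left mult.commute cong: if_cong)
  ultimately have "((\<lambda>t. complex_of_real ((cmod (trig_poly A c \<nu> t))\<^sup>2)) has_integral
      complex_of_real (L * (\<Sum>j\<in>A. (cmod (c j))\<^sup>2))) {\<alpha>..\<alpha> + L}"
    by simp
  from has_integral_linear[OF this bounded_linear_Re] show ?thesis
    by (auto simp: o_def intro!: integral_unique)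
qed

text \<open>Bernstein's inequality in mean square: differentiation multiplies each coefficient by at
  most \<open>pi\<close> in modulus, so the bracket in \<open>energy\<close> keeps at least the
  fraction \<open>1 - \<delta>\<close>.\<close>

lemma energy_trig_poly_ge:
  assumes fin: "finite A" and L: "(L :: real) \<ge> 0"
    and sep: "\<And>j k. j \<in> A \<Longrightarrow> k \<in> A \<Longrightarrow> j \<noteq> k \<Longrightarrow> \<exists>n::int. n \<noteq> 0 \<and> (\<nu> j - \<nu> k) * L = n"
    and band: "\<And>j. j \<in> A \<Longrightarrow> \<bar>\<nu> j\<bar> \<le> 1 / 2" and \<delta>: "0 < \<delta>" "\<delta> < 1"
  shows "(1 - \<delta>)\<^sup>2 * (L * (\<Sum>j\<in>A. (cmod (c j))\<^sup>2))
    \<le> C1_curve.energy (trig_poly A c \<nu>) (trig_poly A (\<lambda>j. c j * (\<i> * (2 * pi * \<nu> j))) \<nu>) (- \<delta>) \<alpha> (\<alpha> + L)"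
proof -
  interpret C1_curve "trig_poly A c \<nu>" "trig_poly A (\<lambda>j. c j * (\<i> * (2 * pi * \<nu> j))) \<nu>"
    by (rule trig_poly_C1)
  let ?S = "\<Sum>j\<in>A. (cmod (c j))\<^sup>2"
  have "(\<Sum>j\<in>A. (cmod (c j * (\<i> * (2 * pi * \<nu> j))))\<^sup>2) \<le> (\<Sum>j\<in>A. pi\<^sup>2 * (cmod (c j))\<^sup>2)"
  proof (rule sum_mono)
    fix j assume "j \<in> A"
    then have "(2 * pi * \<bar>\<nu> j\<bar>)\<^sup>2 \<le> pi\<^sup>2" using band[of j] by (intro power_mono) auto
    then have "(cmod (c j))\<^sup>2 * (2 * pi * \<bar>\<nu> j\<bar>)\<^sup>2 \<le> (cmod (c j))\<^sup>2 * pi\<^sup>2" by (rule mult_left_mono) simp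
    then show "(cmod (c j * (\<i> * (2 * pi * \<nu> j))))\<^sup>2 \<le> pi\<^sup>2 * (cmod (c j))\<^sup>2"
      by (simp add: norm_mult power_mult_distrib mult_ac)
  qed
  then have "\<delta> / pi\<^sup>2 * (L * (\<Sum>j\<in>A. (cmod (c j * (\<i> * (2 * pi * \<nu> j))))\<^sup>2)) \<le> \<delta> / pi\<^sup>2 * (L * (pi\<^sup>2 * ?S))"
    using \<delta> L by (intro mult_left_mono) (auto simp: sum_distrib_left)
  also have "\<dots> = \<delta> * (L * ?S)" by simp
  finally have "(1 - \<delta>) * ((1 - \<delta>) * (L * ?S)) \<le> (1 - \<delta>) * (L * ?S - \<delta> / pi\<^sup>2 * (L * (\<Sum>j\<in>A. (cmod (c j * (\<i> * (2 * pi * \<nu> j))))\<^sup>2)))"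
    using \<delta> by (intro mult_left_mono) (auto simp: algebra_simps)
  then show ?thesis
    unfolding energy_def by (subst (1 2) integral_norm_sq_trig_poly[OF fin L sep]) (auto simp: power2_eq_square algebra_simps)
qed

text \<open>\<open>sinc_fn 0 = 0\<close> because of division by zero; \<open>sinc_cont\<close> has the value \<open>1\<close> there.\<close>

definition sinc_cont :: "real \<Rightarrow> real" where
  "sinc_cont x = (if x = 0 then 1 else sinc_fn x)"

text \<open>Monotonicity of \<open>sin x / x\<close>, in product form so that \<open>x = 0\<close>
  is included.\<close>

lemma mult_sin_antimono:
  assumes "0 \<le> x" "x \<le> y" "y \<le> pi"
  shows "x * sin y \<le> y * sin x"
proof (cases "x = 0")
  case False
  have "sin y / y \<le> sin x / x"
  proof (rule DERIV_nonpos_imp_nonincreasing[OF assms(2)])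
    fix t assume t: "x \<le> t" "t \<le> y"
    have tpos: "0 < t" "t \<le> pi" using t assms False by auto
    \<comment> \<open>This numerator of the derivative of \<open>sin t / t\<close> vanishes at 0 and
      has derivative \<open>- (t * sin t)\<close>.\<close>
    have "t * cos t - sin t \<le> 0 * cos 0 - sin 0"
    proof (rule DERIV_nonpos_imp_nonincreasing[of 0 t "\<lambda>t. t * cos t - sin t"])
      fix s assume s: "0 \<le> s" "s \<le> t"
      have "((\<lambda>t. t * cos t - sin t) has_real_derivative - (s * sin s)) (at s)"
        by (auto intro!: derivative_eq_intros)
      moreover have "0 \<le> s * sin s" using s tpos by (intro mult_nonneg_nonneg sin_ge_zero) auto
      ultimately show "\<exists>y. ((\<lambda>t. t * cos t - sin t) has_real_derivative y) (at s) \<and> y \<le> 0"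
        by (intro exI[of _ "- (s * sin s)"]) auto
    qed (use tpos in auto)
    then have "(t * cos t - sin t) / t\<^sup>2 \<le> 0" by (simp add: divide_nonpos_nonneg)
    moreover have "((\<lambda>t. sin t / t) has_real_derivative (t * cos t - sin t) / t\<^sup>2) (at t)"
      using tpos by (auto intro!: derivative_eq_intros simp: power2_eq_square field_simps)
    ultimately show "\<exists>y. ((\<lambda>t. sin t / t) has_real_derivative y) (at t) \<and> y \<le> 0" by blast
  qed
  then show ?thesis using False assms by (simp add: field_simps)
qed simp

lemma sinc_cont_ge:
  assumes "\<bar>x\<bar> \<le> y" "0 < y" "y \<le> pi"
  shows "sinc_fn y \<le> sinc_cont x"
proof (cases "x = 0")
  case True
  then show ?thesis using assms sin_x_le_x[of y] by (simp add: sinc_cont_def sinc_fn_def field_simps)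
next
  case False
  have "\<bar>x\<bar> * sin y \<le> y * sin \<bar>x\<bar>" using assms by (intro mult_sin_antimono) auto
  then have "sin y / y \<le> sin \<bar>x\<bar> / \<bar>x\<bar>" using assms False by (simp add: field_simps)
  also have "\<dots> = sin x / x" by (simp add: abs_if)
  finally show ?thesis using False by (simp add: sinc_cont_def sinc_fn_def)
qed

text \<open>By the double angle formula sinc at \<open>x\<close> is \<open>cos (x / 2)\<close> times
  sinc at \<open>x / 2\<close>, and Jordan's inequality bounds the latter below by
  \<open>2 / pi\<close>.\<close>

lemma sinc_cont_ge_cos:
  assumes "\<bar>x\<bar> \<le> pi"
  shows "2 / pi * cos (x / 2) \<le> sinc_cont x"
proof (cases "x = 0")
  case True
  then show ?thesis using pi_ge_two by (simp add: sinc_cont_def field_simps)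
next
  case False
  have c: "0 \<le> cos (x / 2)" using assms by (intro cos_ge_zero) auto
  have "\<bar>x / 2\<bar> * sin (pi / 2) \<le> pi / 2 * sin \<bar>x / 2\<bar>" using assms by (intro mult_sin_antimono) auto
  then have "2 / pi \<le> sin \<bar>x / 2\<bar> / \<bar>x / 2\<bar>" using False by (simp add: field_simps)
  also have "\<dots> = sin (x / 2) / (x / 2)" by (simp add: abs_if)
  finally have "2 / pi * cos (x / 2) \<le> sin (x / 2) / (x / 2) * cos (x / 2)" using c by (rule mult_right_mono)
  also have "\<dots> = sin x / x" using sin_double[of "x / 2"] False by (simp add: field_simps)
  finally show ?thesis using False by (simp add: sinc_cont_def sinc_fn_def)
qed

lemma fourier_indicator_cell:
  assumes "0 < (M :: nat)"
  shows "(LINT x|lborel. indicator {real m / M..(real m + 1) / M} x *\<^sub>R exp (- 2 * pi * \<i> * complex_of_real (w * x)))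
    = cis (- 2 * pi * w * ((real m + 1 / 2) / M)) * (sinc_cont (pi * w / M) / M)"
proof -
  let ?a = "real m / M" and ?b = "(real m + 1) / M"
  have ab: "?a \<le> ?b" using assms by (simp add: divide_right_mono)
  have e: "exp (- 2 * pi * \<i> * complex_of_real (w * x)) = cis ((- 2 * pi * w) * x)" for x
    by (simp add: cis_conv_exp algebra_simps)
  show ?thesis
  proof (cases "w = 0")
    case True
    have "(LINT x|lborel. indicator {?a..?b} x *\<^sub>R (1 :: complex)) = complex_of_real ?b - complex_of_real ?a"
      using ab by (intro integral_FTC_atLeastAtMost) (auto intro!: derivative_eq_intros)
    also have "\<dots> = 1 / M" using assms by (simp add: field_simps)
    finally show ?thesis using True by (simp add: sinc_cont_def)
  next
    case False
    let ?s = "- 2 * pi * w"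
    have s: "?s \<noteq> 0" using False by simp
    let ?c = "(real m + 1 / 2) / M" and ?\<theta> = "pi * w / M"
    have "(LINT x|lborel. indicator {?a..?b} x *\<^sub>R cis (?s * x)) = cis (?s * ?b) / (\<i> * ?s) - cis (?s * ?a) / (\<i> * ?s)"
    proof (rule integral_FTC_atLeastAtMost[OF ab])
      fix t
      have "((\<lambda>t. cis (?s * t) / (\<i> * ?s)) has_vector_derivative (\<i> * ?s * cis (?s * t)) / (\<i> * ?s)) (at t within {?a..?b})"
        by (intro has_vector_derivative_divide has_vector_derivative_cis_linear)
      moreover have "(\<i> * ?s * cis (?s * t)) / (\<i> * ?s) = cis (?s * t)" using s by simp
      ultimately show "((\<lambda>t. cis (?s * t) / (\<i> * ?s)) has_vector_derivative cis (?s * t)) (at t within {?a..?b})"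
        by (simp only:)
    qed (intro continuous_intros)
    \<comment> \<open>Splitting both ends about the cell midpoint \<open>?c\<close> pulls out the
      phase; the remaining conjugate exponentials differ by a sine.\<close>
    also have "?s * ?b = ?s * ?c + - ?\<theta>" using assms by (simp add: field_simps)
    also have "?s * ?a = ?s * ?c + ?\<theta>" using assms by (simp add: field_simps)
    also have "cis (?s * ?c + - ?\<theta>) / (\<i> * ?s) - cis (?s * ?c + ?\<theta>) / (\<i> * ?s)
        = cis (?s * ?c) * ((cis (- ?\<theta>) - cis ?\<theta>) / (\<i> * ?s))"
      unfolding cis_mult[symmetric] by (simp add: diff_divide_distrib right_diff_distrib)
    also have "cis (- ?\<theta>) - cis ?\<theta> = - 2 * \<i> * sin ?\<theta>"
      by (simp add: complex_eq_iff)
    also have "(- 2 * \<i> * sin ?\<theta>) / (\<i> * ?s) = sinc_cont ?\<theta> / M"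
      using False assms by (simp add: sinc_cont_def sinc_fn_def field_simps)
    finally show ?thesis unfolding e .
  qed
qed

section \<open>The upper frame bound\<close>

lemma H_spaceD:
  assumes "f \<in> H_space"
  shows "f \<in> borel_measurable borel" "integrable lborel (\<lambda>x. (cmod (f x))\<^sup>2)" "x \<notin> {0..1} \<Longrightarrow> f x = 0"
  using assms by (auto simp: H_space_def is_L2_def)

lemma L2_norm_sq: "(L2_norm f)\<^sup>2 = (LINT x|lborel. (cmod (f x))\<^sup>2)"
  unfolding L2_norm_def by (rule real_sqrt_pow2) (simp add: integral_nonneg_AE)

lemma H_space_integrable:
  assumes "f \<in> H_space"
  shows "integrable lborel f"
proof (rule Bochner_Integration.integrable_bound)
  show "integrable lborel (\<lambda>x. indicator {0..1} x + (cmod (f x))\<^sup>2 :: real)"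
    using H_spaceD[OF assms] by (intro Bochner_Integration.integrable_add) auto
  show "f \<in> borel_measurable lborel" using H_spaceD[OF assms] by simp
  have "norm (f x) \<le> norm (indicator {0..1} x + (cmod (f x))\<^sup>2 :: real)" for x
  proof (cases "x \<in> {0..1}")
    case True
    have "0 \<le> (cmod (f x) - 1 / 2)\<^sup>2" by simp
    then have "cmod (f x) \<le> 1 + (cmod (f x))\<^sup>2" by (simp add: power2_eq_square algebra_simps)
    then show ?thesis using True by simp
  qed (simp add: H_spaceD(3)[OF assms])
  then show "AE x in lborel. norm (f x) \<le> norm (indicator {0..1} x + (cmod (f x))\<^sup>2 :: real)" by simp
qed

lemma H_space_integrable_mult:
  assumes f: "f \<in> H_space" and g: "continuous_on UNIV g"
  shows "integrable lborel (\<lambda>x. f x * g x)"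
proof -
  have "bounded (g ` {0..1::real})"
    by (intro compact_imp_bounded compact_continuous_image continuous_on_subset[OF g]) auto
  then obtain B where B: "\<And>x. x \<in> {0..1} \<Longrightarrow> cmod (g x) \<le> B"
    unfolding bounded_iff by (meson imageI)
  show ?thesis
  proof (rule Bochner_Integration.integrable_bound)
    show "integrable lborel (\<lambda>x. B * cmod (f x))" using H_space_integrable[OF f] by simp
    show "(\<lambda>x. f x * g x) \<in> borel_measurable lborel"
      using H_spaceD(1)[OF f] borel_measurable_continuous_onI[OF g] by simp
    have "norm (f x * g x) \<le> norm (B * cmod (f x))" for x
    proof (cases "x \<in> {0..1}")
      case True
      then have "cmod (f x) * cmod (g x) \<le> cmod (f x) * B" by (intro mult_left_mono B) auto
      then show ?thesis by (simp add: norm_mult mult.commute)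
    qed (simp add: H_spaceD(3)[OF f])
    then show "AE x in lborel. norm (f x * g x) \<le> norm (B * cmod (f x))" by simp
  qed
qed

lemma fourier_cis: "fourier f w = (LINT x|lborel. f x * cis (- (2 * pi * w * x)))"
  unfolding fourier_def by (intro Bochner_Integration.integral_cong refl) (simp add: cis_conv_exp algebra_simps)

text \<open>Modulating by \<open>cis (pi * w)\<close> moves the support to \<open>[-1/2, 1/2]\<close>, which halves the bandwidth.\<close>

definition centred_fourier :: "(real \<Rightarrow> complex) \<Rightarrow> real \<Rightarrow> complex" where
  "centred_fourier f w = (LINT x|lborel. f x * cis (- (2 * pi * w * (x - 1 / 2))))"

lemma cmod_centred_fourier: "cmod (centred_fourier f w) = cmod (fourier f w)"
proof -
  have "centred_fourier f w = (LINT x|lborel. f x * cis (- (2 * pi * w * x)) * cis (pi * w))"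
    unfolding centred_fourier_def mult.assoc cis_mult by (simp add: algebra_simps)
  also have "\<dots> = fourier f w * cis (pi * w)"
    unfolding fourier_cis by (rule Bochner_Integration.integral_mult_left_zero)
  finally show ?thesis by (simp add: norm_mult)
qed

text \<open>For fixed \<open>t\<close> the exponentials with frequencies \<open>t + j\<close> are
  orthonormal on \<open>[0, 1]\<close>. The polynomial \<open>P\<close> is the projection of
  \<open>f\<close> onto their span, and the claim is that \<open>f - P\<close> has nonnegative
  square norm.\<close>

lemma bessel_shifted:
  assumes f: "f \<in> H_space"
  shows "(\<Sum>j<n. (cmod (fourier f (t + real j)))\<^sup>2) \<le> (L2_norm f)\<^sup>2"
proof -
  define c where "c = (\<lambda>j. fourier f (t + real j))"
  define P where "P = trig_poly {..<n} c (\<lambda>j. t + real j)"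
  let ?S = "\<Sum>j<n. (cmod (c j))\<^sup>2"
  have contP: "continuous_on A P" for A unfolding P_def trig_poly_def by (intro continuous_intros)
  have "set_integrable lborel {0..1} (\<lambda>x. (cmod (P x))\<^sup>2)"
    by (intro borel_integrable_atLeastAtMost' continuous_intros contP)
  then have Pint: "integrable lborel (\<lambda>x. indicator {0..1} x * (cmod (P x))\<^sup>2)"
    and "(LINT x|lborel. indicator {0..1} x * (cmod (P x))\<^sup>2) = integral {0..1} (\<lambda>x. (cmod (P x))\<^sup>2)"
    using set_borel_integral_eq_integral(2)[of "{0..1}" "\<lambda>x. (cmod (P x))\<^sup>2"]
    by (auto simp: set_integrable_def set_lebesgue_integral_def)
  moreover have "integral {0..0 + 1} (\<lambda>x. (cmod (P x))\<^sup>2) = 1 * ?S"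
    unfolding P_def
  proof (rule integral_norm_sq_trig_poly)
    fix j k :: nat assume "j \<noteq> k"
    then show "\<exists>n::int. n \<noteq> 0 \<and> (t + real j - (t + real k)) * 1 = n"
      by (intro exI[of _ "int j - int k"]) auto
  qed auto
  ultimately have PP: "(LINT x|lborel. indicator {0..1} x * (cmod (P x))\<^sup>2) = ?S" by simp
  have fP: "f x * cnj (P x) = (\<Sum>j<n. cnj (c j) * (f x * cis (- (2 * pi * (t + real j) * x))))" for x
    by (simp add: P_def trig_poly_def sum_distrib_left cis_cnj mult_ac)
  have int1: "integrable lborel (\<lambda>x. f x * cis (- (2 * pi * (t + real j) * x)))" for j
    by (intro H_space_integrable_mult f continuous_intros)
  have intfP: "integrable lborel (\<lambda>x. f x * cnj (P x))"
    unfolding fP by (intro Bochner_Integration.integrable_sum integrable_mult_right int1)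
  have "(LINT x|lborel. f x * cnj (P x)) = (\<Sum>j<n. cnj (c j) * c j)"
    unfolding fP by (subst Bochner_Integration.integral_sum) (auto intro!: integrable_mult_right int1 simp: c_def fourier_cis)
  also have "\<dots> = complex_of_real ?S"
    unfolding of_real_sum complex_norm_square by (simp add: mult.commute)
  finally have fPS: "(LINT x|lborel. Re (f x * cnj (P x))) = ?S"
    using integral_Re[OF intfP] by simp
  have "0 \<le> (LINT x|lborel. (cmod (f x))\<^sup>2 - 2 * Re (f x * cnj (P x)) + indicator {0..1} x * (cmod (P x))\<^sup>2)"
  proof (intro integral_nonneg_AE AE_I2)
    fix x
    have "0 \<le> (cmod (f x - P x))\<^sup>2" by simp
    also have "(cmod (f x - P x))\<^sup>2 = (cmod (f x))\<^sup>2 - 2 * Re (f x * cnj (P x)) + (cmod (P x))\<^sup>2"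
      unfolding cmod_power2 by (simp add: power2_eq_square algebra_simps)
    finally show "0 \<le> (cmod (f x))\<^sup>2 - 2 * Re (f x * cnj (P x)) + indicator {0..1} x * (cmod (P x))\<^sup>2"
      using H_spaceD(3)[OF f, of x] by (cases "x \<in> {0..1}") auto
  qed
  also have "\<dots> = (L2_norm f)\<^sup>2 - 2 * ?S + ?S"
    using H_spaceD(2)[OF f] integrable_Re[OF intfP] Pint fPS PP
    by (simp add: L2_norm_sq del: times_complex.sel)
  finally show ?thesis by (simp add: c_def)
qed

text \<open>Averaging Bessel's inequality over the shift \<open>t\<close> replaces Plancherel's theorem.\<close>

lemma integral_le_of_shifted_sums:
  fixes q :: "real \<Rightarrow> real"
  assumes cont: "continuous_on UNIV q" and nonneg: "\<And>t. 0 \<le> q t"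
    and bound: "\<And>t n. (\<Sum>j<n. q (t + real j)) \<le> S" and ab: "a \<le> b"
  shows "integral {a..b} q \<le> S"
proof -
  have c: "continuous_on A q" for A using cont continuous_on_subset by blast
  have qi: "q integrable_on {x..y}" for x y by (intro integrable_continuous_interval c)
  have csh: "continuous_on A (\<lambda>t. q (t + s))" for A s
    by (intro continuous_on_compose2[OF cont] continuous_intros) auto
  have sum: "integral {a..a + real n} q = integral {a..a + 1} (\<lambda>t. \<Sum>j<n. q (t + real j))" for n
  proof (induction n)
    case (Suc n)
    have "integral {a..a + real (Suc n)} q = integral {a..a + real n} q + integral {a + real n..a + real (Suc n)} q"
      by (rule Henstock_Kurzweil_Integration.integral_combine[symmetric]) (auto intro: qi)
    also have "integral {a + real n..a + real (Suc n)} q = integral {a..a + 1} (\<lambda>t. q (t + real n))"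
      using integral_shift[where a = a and b = "a + 1" and c = "real n" and f = q, OF c] by (simp add: o_def add_ac)
    finally show ?case unfolding Suc.IH
      by (simp add: Henstock_Kurzweil_Integration.integral_add[OF integrable_continuous_interval integrable_continuous_interval]
          continuous_intros csh)
  qed simp
  define n where "n = nat \<lceil>b - a\<rceil>"
  have "b - a \<le> real n" unfolding n_def by linarith
  then have "integral {a..b} q \<le> integral {a..a + real n} q"
    using qi nonneg by (intro integral_subset_le) auto
  also have "\<dots> \<le> integral {a..a + 1} (\<lambda>t. S)"
    unfolding sum by (intro integral_le integrable_continuous_interval continuous_intros csh bound)
  finally show ?thesis by simp
qed

text \<open>Differentiation under the integral with an explicit remainder: on the support the phase
  change \<theta> is at most \<open>pi * \<bar>s - t\<bar>\<close> in modulus, and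
  \<open>cis \<theta>\<close> differs from its linear part by at most
  \<open>\<theta>\<^sup>2\<close>.\<close>

lemma centred_fourier_deriv:
  assumes f: "f \<in> H_space"
  shows "(centred_fourier f has_vector_derivative
    centred_fourier (\<lambda>x. f x * (\<i> * complex_of_real (- 2 * pi * (x - 1 / 2)))) t) (at t)"
proof -
  let ?e = "\<lambda>s x. cis (- (2 * pi * s * (x - 1 / 2)))"
  let ?g = "centred_fourier f"
  let ?g' = "centred_fourier (\<lambda>x. f x * (\<i> * complex_of_real (- 2 * pi * (x - 1 / 2))))"
  define C where "C = (LINT x|lborel. pi\<^sup>2 * cmod (f x))"
  have i1: "integrable lborel (\<lambda>x. f x * ?e s x)" for s
    by (intro H_space_integrable_mult f continuous_intros)
  have i2: "integrable lborel (\<lambda>x. f x * (\<i> * complex_of_real (- 2 * pi * (x - 1 / 2))) * ?e s x)" for s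
    unfolding mult.assoc[of "f _"] by (intro H_space_integrable_mult f continuous_intros)
  have bound: "cmod (?g s - ?g t - (s - t) *\<^sub>R ?g' t) \<le> C * (s - t)\<^sup>2" for s
  proof -
    let ?d = "\<lambda>x. f x * ?e s x - f x * ?e t x - (s - t) *\<^sub>R (f x * (\<i> * complex_of_real (- 2 * pi * (x - 1 / 2))) * ?e t x)"
    have di: "integrable lborel ?d"
      by (intro Bochner_Integration.integrable_diff integrable_scaleR_right i1 i2)
    have eq: "?g s - ?g t - (s - t) *\<^sub>R ?g' t = (LINT x|lborel. ?d x)"
      unfolding centred_fourier_def by (simp only: i1 i2 Bochner_Integration.integral_diff Bochner_Integration.integrable_diff
        integrable_scaleR_right Bochner_Integration.integral_scaleR_right)
    have "cmod (?g s - ?g t - (s - t) *\<^sub>R ?g' t) \<le> (LINT x|lborel. norm (?d x))"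
      unfolding eq by (rule integral_norm_bound)
    also have "\<dots> \<le> (LINT x|lborel. pi\<^sup>2 * cmod (f x) * (s - t)\<^sup>2)"
    proof (rule integral_mono)
      fix x
      show "norm (?d x) \<le> pi\<^sup>2 * cmod (f x) * (s - t)\<^sup>2"
      proof (cases "x \<in> {0..1}")
        case True
        define \<theta> where "\<theta> = - (2 * pi * (s - t) * (x - 1 / 2))"
        have es: "?e s x = ?e t x * cis \<theta>"
          unfolding cis_mult \<theta>_def by (simp add: algebra_simps)
        have "?d x = f x * ?e t x * (cis \<theta> - 1 - \<i> * \<theta>)"
          unfolding es by (simp add: \<theta>_def scaleR_conv_of_real algebra_simps)
        then have eq: "norm (?d x) = cmod (f x) * cmod (cis \<theta> - 1 - \<i> * \<theta>)" by (simp add: norm_mult)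
        have "cmod (cis \<theta> - 1 - \<i> * \<theta>) \<le> \<theta>\<^sup>2"
          using Taylor_exp[of "\<i> * \<theta>" 1] by (simp add: cis_conv_exp norm_mult power2_eq_square diff_diff_eq)
        also have "\<theta>\<^sup>2 = pi\<^sup>2 * (s - t)\<^sup>2 * (2 * \<bar>x - 1 / 2\<bar>)\<^sup>2"
          by (simp add: \<theta>_def power_mult_distrib)
        also have "\<dots> \<le> pi\<^sup>2 * (s - t)\<^sup>2 * 1\<^sup>2"
          using True by (intro mult_left_mono power_mono) (auto simp: abs_if)
        finally have "cmod (f x) * cmod (cis \<theta> - 1 - \<i> * \<theta>) \<le> cmod (f x) * (pi\<^sup>2 * (s - t)\<^sup>2)"
          by (intro mult_left_mono) auto
        then show ?thesis unfolding eq by (simp only: mult_ac)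
      qed (simp add: H_spaceD(3)[OF f])
    qed (use di H_space_integrable[OF f] in auto)
    finally show ?thesis by (simp add: C_def)
  qed
  have "((\<lambda>s. norm (?g s - ?g t - (s - t) *\<^sub>R ?g' t) / norm (s - t)) \<longlongrightarrow> 0) (at t)"
  proof (rule tendsto_sandwich[of "\<lambda>_. 0"])
    have "norm (?g s - ?g t - (s - t) *\<^sub>R ?g' t) / norm (s - t) \<le> C * \<bar>s - t\<bar>" if "s \<noteq> t" for s
      using bound[of s] that by (simp add: divide_le_eq mult.assoc power2_eq_square[symmetric] abs_mult_self_eq)
    then show "\<forall>\<^sub>F s in at t. norm (?g s - ?g t - (s - t) *\<^sub>R ?g' t) / norm (s - t) \<le> C * \<bar>s - t\<bar>"
      by (auto simp: eventually_at_filter)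
    have "((\<lambda>s. C * \<bar>s - t\<bar>) \<longlongrightarrow> C * \<bar>t - t\<bar>) (at t)" by (intro tendsto_intros)
    then show "((\<lambda>s. C * \<bar>s - t\<bar>) \<longlongrightarrow> 0) (at t)" by simp
  qed auto
  then show ?thesis
    unfolding has_vector_derivative_def has_derivative_iff_norm
    by (auto intro: bounded_linear_scaleR_left)
qed

text \<open>Centring makes the multiplier at most \<open>pi\<close> in modulus on the support. As
  the product stays in \<open>H_space\<close>, the derivative of the transform obeys the same
  estimates as the transform.\<close>

lemma H_space_mult_centred:
  assumes f: "f \<in> H_space"
  shows "(\<lambda>x. f x * (\<i> * complex_of_real (- 2 * pi * (x - 1 / 2)))) \<in> H_space" (is "?h \<in> _")
    and "(L2_norm (\<lambda>x. f x * (\<i> * complex_of_real (- 2 * pi * (x - 1 / 2)))))\<^sup>2 \<le> pi\<^sup>2 * (L2_norm f)\<^sup>2"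
proof -
  have bound: "(cmod (?h x))\<^sup>2 \<le> pi\<^sup>2 * (cmod (f x))\<^sup>2" for x
  proof (cases "x \<in> {0..1}")
    case True
    have "(cmod (?h x))\<^sup>2 = (cmod (f x))\<^sup>2 * (2 * pi * \<bar>x - 1 / 2\<bar>)\<^sup>2"
      unfolding norm_mult norm_of_real by (simp add: power_mult_distrib abs_mult)
    also have "2 * pi * \<bar>x - 1 / 2\<bar> \<le> pi" using True by (simp add: abs_if)
    then have "(cmod (f x))\<^sup>2 * (2 * pi * \<bar>x - 1 / 2\<bar>)\<^sup>2 \<le> (cmod (f x))\<^sup>2 * pi\<^sup>2"
      by (intro mult_left_mono power_mono) auto
    finally show ?thesis by (simp add: mult.commute)
  qed (simp add: H_spaceD(3)[OF f])
  have m: "?h \<in> borel_measurable borel"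
    using H_spaceD(1)[OF f] by measurable
  have i: "integrable lborel (\<lambda>x. (cmod (?h x))\<^sup>2)"
  proof (rule Bochner_Integration.integrable_bound)
    show "integrable lborel (\<lambda>x. pi\<^sup>2 * (cmod (f x))\<^sup>2)" using H_spaceD(2)[OF f] by simp
    show "AE x in lborel. norm ((cmod (?h x))\<^sup>2) \<le> norm (pi\<^sup>2 * (cmod (f x))\<^sup>2)"
      using bound by (intro AE_I2) simp
  qed (use m in measurable)
  show "?h \<in> H_space" using m i H_spaceD(3)[OF f] by (auto simp: H_space_def is_L2_def)
  have "(LINT x|lborel. (cmod (?h x))\<^sup>2) \<le> (LINT x|lborel. pi\<^sup>2 * (cmod (f x))\<^sup>2)"
    using i bound H_spaceD(2)[OF f] by (intro integral_mono) auto
  then show "(L2_norm ?h)\<^sup>2 \<le> pi\<^sup>2 * (L2_norm f)\<^sup>2" by (simp add: L2_norm_sq)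
qed

lemma centred_fourier_C1:
  assumes f: "f \<in> H_space"
  shows "C1_curve (centred_fourier f) (centred_fourier (\<lambda>x. f x * (\<i> * complex_of_real (- 2 * pi * (x - 1 / 2)))))"
proof
  show "(centred_fourier f has_vector_derivative
    centred_fourier (\<lambda>x. f x * (\<i> * complex_of_real (- 2 * pi * (x - 1 / 2)))) t) (at t)" for t
    by (rule centred_fourier_deriv[OF f])
  show "continuous_on UNIV (centred_fourier (\<lambda>x. f x * (\<i> * complex_of_real (- 2 * pi * (x - 1 / 2)))))"
    using centred_fourier_deriv[OF H_space_mult_centred(1)[OF f]]
    by (meson continuous_at_imp_continuous_on has_vector_derivative_continuous)
qed

lemma integral_centred_fourier_le:
  assumes f: "f \<in> H_space" and "a \<le> b"
  shows "integral {a..b} (\<lambda>t. (cmod (centred_fourier f t))\<^sup>2) \<le> (L2_norm f)\<^sup>2"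
proof (rule integral_le_of_shifted_sums[OF _ _ _ assms(2)])
  interpret C1_curve "centred_fourier f" "centred_fourier (\<lambda>x. f x * (\<i> * complex_of_real (- 2 * pi * (x - 1 / 2))))"
    by (rule centred_fourier_C1[OF f])
  show "continuous_on UNIV (\<lambda>t. (cmod (centred_fourier f t))\<^sup>2)" by (intro continuous_intros cont)
qed (use bessel_shifted[OF f] in \<open>auto simp: cmod_centred_fourier\<close>)

lemma (in sampling_scheme) samples_upper:
  assumes f: "f \<in> H_space"
  shows "(\<Sum>n=1..N. \<mu> n * (cmod (fourier f (X n)))\<^sup>2) \<le> (1 + \<delta>)\<^sup>2 * (L2_norm f)\<^sup>2"
proof -
  let ?h = "\<lambda>x. f x * (\<i> * complex_of_real (- 2 * pi * (x - 1 / 2)))"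
  let ?a = "(X 0 + X 1) / 2" and ?b = "(X N + X (N + 1)) / 2"
  interpret sampled_curve K \<delta> N w "centred_fourier f" "centred_fourier ?h"
    unfolding sampled_curve_def using sampling_scheme_axioms centred_fourier_C1[OF f] by simp
  have ab: "?a \<le> ?b" using X_mono[of 0 N] X_mono[of 1 "N + 1"] N_pos by simp
  have "(\<Sum>n=1..N. \<mu> n * (cmod (fourier f (X n)))\<^sup>2) \<le> energy \<delta> ?a ?b"
    using nodes_upper by (simp add: cmod_centred_fourier)
  also have "\<dots> \<le> (1 + \<delta>) * ((L2_norm f)\<^sup>2 + \<delta> / pi\<^sup>2 * (pi\<^sup>2 * (L2_norm f)\<^sup>2))"
    unfolding energy_def
    using integral_centred_fourier_le[OF f ab] integral_centred_fourier_le[OF H_space_mult_centred(1)[OF f] ab]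
      H_space_mult_centred(2)[OF f] \<delta>_pos
    by (intro mult_left_mono add_mono) auto
  also have "\<dots> = (1 + \<delta>)\<^sup>2 * (L2_norm f)\<^sup>2" by (simp add: power2_eq_square algebra_simps)
  finally show ?thesis .
qed

lemma (in sampling_scheme) inner_sampling_op:
  assumes f: "f \<in> H_space"
  shows "Re (L2_inner (sampling_op K N w f) f) = (\<Sum>n=1..N. \<mu> n * (cmod (fourier f (X n)))\<^sup>2)"
proof -
  have i: "integrable lborel (\<lambda>x. f x * cis (- (2 * pi * s * x)))" for s
    by (intro H_space_integrable_mult f continuous_intros)
  have "sampling_op K N w f x * cnj (f x)
      = (\<Sum>n=1..N. (\<mu> n * fourier f (w n)) * cnj (f x * cis (- (2 * pi * w n * x))))" for x
  proof (cases "x \<in> {0..1}")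
    case True
    then show ?thesis
      by (simp add: sampling_op_def sum_distrib_right cis_cnj) (simp add: cis_conv_exp mult_ac)
  qed (simp add: H_spaceD(3)[OF f])
  then have "L2_inner (sampling_op K N w f) f
      = (LINT x|lborel. (\<Sum>n=1..N. (\<mu> n * fourier f (w n)) * cnj (f x * cis (- (2 * pi * w n * x)))))"
    unfolding L2_inner_def by (simp only:)
  also have "\<dots> = (\<Sum>n=1..N. (LINT x|lborel. (\<mu> n * fourier f (w n)) * cnj (f x * cis (- (2 * pi * w n * x)))))"
    by (intro Bochner_Integration.integral_sum integrable_mult_right integrable_cnj i)
  also have "\<dots> = (\<Sum>n=1..N. (\<mu> n * fourier f (w n)) * cnj (fourier f (w n)))"
    by (simp only: Bochner_Integration.integral_mult_right_zero Bochner_Integration.integral_cnj fourier_cis)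
  also have "\<dots> = (\<Sum>n=1..N. complex_of_real (\<mu> n * (cmod (fourier f (X n)))\<^sup>2))"
    by (intro sum.cong refl) (simp add: X_eq complex_norm_square[symmetric] mult.assoc del: of_real_power)
  finally show ?thesis by (simp del: of_real_mult)
qed

section \<open>The lower frame bound\<close>

text \<open>The offset of the midpoint of cell \<open>m\<close> from \<open>1 / 2\<close>, with the
  sign of the Fourier exponent.\<close>

definition cell_freq :: "nat \<Rightarrow> nat \<Rightarrow> real" where
  "cell_freq M m = 1 / 2 - (real m + 1 / 2) / real M"

lemma indicator_cell:
  assumes "0 < M"
  shows "indicator {0..1::real} (real M * x - real m) = (indicator {real m / M..(real m + 1) / M} x :: 'a :: zero_neq_one)"
proof -
  have "real M * x - real m \<in> {0..1} \<longleftrightarrow> x \<in> {real m / M..(real m + 1) / M}"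
    using assms by (auto simp: field_simps)
  then show ?thesis by (simp add: indicator_def)
qed

text \<open>Closed neighbouring cells share an endpoint, so the generators of \<open>U_space\<close>
  are orthogonal only up to a null set.\<close>

lemma measure_cell_Int:
  assumes "0 < (M :: nat)"
  shows "measure lborel ({real j / M..(real j + 1) / M} \<inter> {real k / M..(real k + 1) / M}) = (if j = k then 1 / M else 0)"
proof (cases "j = k")
  case True
  then show ?thesis using assms by (simp add: divide_right_mono field_simps)
next
  case False
  have *: "measure lborel ({real j / M..(real j + 1) / M} \<inter> {real k / M..(real k + 1) / M}) = 0" if "j < k" for j k :: nat
  proof -
    have "(real j + 1) / M \<le> real k / M" using that assms by (intro divide_right_mono) auto
    then have "{real j / M..(real j + 1) / M} \<inter> {real k / M..(real k + 1) / M} \<subseteq> {real k / M}" by auto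
    then have "emeasure lborel ({real j / M..(real j + 1) / M} \<inter> {real k / M..(real k + 1) / M}) \<le> emeasure lborel {real k / M}"
      by (intro emeasure_mono) auto
    then show ?thesis by (simp add: measure_def)
  qed
  show ?thesis using False *[of j k] *[of k j] by (cases "j < k") (auto simp: Int_commute)
qed

text \<open>One coefficient vector yields both the norm and the transform, so the lower frame bound
  becomes a statement about a single polynomial.\<close>

lemma U_space_expansion:
  assumes f: "f \<in> U_space M" and M: "0 < M"
  obtains c where "f \<in> H_space" "(L2_norm f)\<^sup>2 = (\<Sum>m<M. (cmod (c m))\<^sup>2)"
    "\<And>w. (cmod (fourier f w))\<^sup>2 = (sinc_cont (pi * w / M))\<^sup>2 / M * (cmod (trig_poly {..<M} c (cell_freq M) w))\<^sup>2"
proof -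
  define I where "I = (\<lambda>m. {real m / M..(real m + 1) / M})"
  from f obtain c where "f = (\<lambda>x. \<Sum>m<M. c m * complex_of_real (sqrt (real M)) * indicator {0..1::real} (real M * x - real m))"
    unfolding U_space_def by blast
  then have fc: "f x = (\<Sum>m<M. c m * sqrt M * indicator (I m) x)" for x
    by (simp add: indicator_cell[OF M] I_def)
  have sq: "complex_of_real ((cmod (f x))\<^sup>2) = (\<Sum>j<M. \<Sum>k<M. (c j * cnj (c k) * M) * complex_of_real (indicator (I j \<inter> I k) x))" for x
  proof -
    have ind: "cnj (indicator (I k) x) = indicator (I k) x" for k by (simp add: indicator_def)
    have "complex_of_real (sqrt M) * complex_of_real (sqrt M) = M"
      by (simp flip: of_real_mult)
    then have "(c j * sqrt M * indicator (I j) x) * cnj (c k * sqrt M * indicator (I k) x)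
        = (c j * cnj (c k) * M) * complex_of_real (indicator (I j \<inter> I k) x)" for j k
      by (simp add: ind indicator_inter_arith of_real_indicator mult_ac)
    then show ?thesis unfolding complex_norm_square fc cnj_sum sum_product by (simp only:)
  qed
  have I_int: "integrable lborel (\<lambda>x. complex_of_real (indicator (I j \<inter> I k) x))" for j k
    unfolding complex_of_real_integrable_eq I_def
    by (intro integrable_real_indicator) (auto simp: emeasure_lborel_Icc_eq)
  have sq_int: "integrable lborel (\<lambda>x. complex_of_real ((cmod (f x))\<^sup>2))"
    unfolding sq by (intro Bochner_Integration.integrable_sum integrable_mult_right I_int)
  have meas: "f \<in> borel_measurable borel"
    unfolding fc[abs_def] I_def by measurable
  have "f \<in> H_space"
    unfolding H_space_def is_L2_def
  proof (intro CollectI conjI allI impI)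
    show "integrable lborel (\<lambda>x. (cmod (f x))\<^sup>2)"
      using sq_int unfolding complex_of_real_integrable_eq .
    fix x :: real assume x: "x \<notin> {0..1}"
    have "x \<notin> I m" if "m < M" for m
    proof
      assume "x \<in> I m"
      then have "real m / M \<le> x" "x \<le> (real m + 1) / M" by (auto simp: I_def)
      moreover have "0 \<le> real m / M" "(real m + 1) / M \<le> 1" using that by auto
      ultimately have "0 \<le> x \<and> x \<le> 1" by (meson order_trans)
      then show False using x by simp
    qed
    then show "f x = 0" by (simp add: fc)
  qed (use meas in simp)
  moreover have "(L2_norm f)\<^sup>2 = (\<Sum>m<M. (cmod (c m))\<^sup>2)"
  proof -
    have "complex_of_real ((L2_norm f)\<^sup>2) = (LINT x|lborel. complex_of_real ((cmod (f x))\<^sup>2))"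
      unfolding L2_norm_sq by (rule Bochner_Integration.integral_complex_of_real[symmetric])
    also have "\<dots> = (\<Sum>j<M. \<Sum>k<M. (c j * cnj (c k) * M) * (LINT x|lborel. complex_of_real (indicator (I j \<inter> I k) x)))"
      unfolding sq
      by (simp only: Bochner_Integration.integral_sum Bochner_Integration.integrable_sum integrable_mult_right I_int
          Bochner_Integration.integral_mult_right_zero)
    also have "\<dots> = (\<Sum>j<M. \<Sum>k<M. (c j * cnj (c k) * M) * (if j = k then complex_of_real (1 / M) else 0))"
    proof (intro sum.cong refl arg_cong2[where f = "(*)"])
      fix j k
      show "(LINT x|lborel. complex_of_real (indicator (I j \<inter> I k) x)) = (if j = k then complex_of_real (1 / M) else 0)"
        using measure_cell_Int[OF M, of j k] by (simp add: I_def)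
    qed
    also have "\<dots> = (\<Sum>j<M. complex_of_real ((cmod (c j))\<^sup>2))"
      using M by (intro sum.cong refl) (simp add: if_distrib[of "\<lambda>x. _ * x"] complex_norm_square[symmetric] del: of_real_power cong: if_cong)
    finally show ?thesis by (metis of_real_eq_iff of_real_sum)
  qed
  moreover have "(cmod (fourier f w))\<^sup>2 = (sinc_cont (pi * w / M))\<^sup>2 / M * (cmod (trig_poly {..<M} c (cell_freq M) w))\<^sup>2" for w
  proof -
    let ?e = "\<lambda>x. exp (- 2 * pi * \<i> * complex_of_real (w * x))"
    let ?s = "sinc_cont (pi * w / M)"
    have "continuous_on A ?e" for A by (intro continuous_intros)
    then have int: "integrable lborel (\<lambda>x. indicator (I m) x *\<^sub>R ?e x)" for m
      using borel_integrable_atLeastAtMost'[of "real m / M" "(real m + 1) / M" ?e]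
      unfolding set_integrable_def I_def by blast
    have "f x * ?e x = (\<Sum>m<M. (c m * sqrt M) * (indicator (I m) x *\<^sub>R ?e x))" for x
      unfolding fc sum_distrib_right by (intro sum.cong refl) (simp add: indicator_def)
    then have "fourier f w = (LINT x|lborel. (\<Sum>m<M. (c m * sqrt M) * (indicator (I m) x *\<^sub>R ?e x)))"
      unfolding fourier_def by (simp only:)
    also have "\<dots> = (\<Sum>m<M. (c m * sqrt M) * (LINT x|lborel. indicator (I m) x *\<^sub>R ?e x))"
      by (simp only: Bochner_Integration.integral_sum integrable_mult_right int Bochner_Integration.integral_mult_right_zero)
    also have "\<dots> = (\<Sum>m<M. (c m * sqrt M) * (cis (- 2 * pi * w * ((real m + 1 / 2) / M)) * (?s / M)))"
      unfolding I_def fourier_indicator_cell[OF M] ..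
    \<comment> \<open>\<open>cis (- pi * w)\<close> is the phase of the common centre
      \<open>1 / 2\<close>; it disappears in the modulus.\<close>
    also have "\<dots> = (sqrt M * (?s / M) * cis (- pi * w)) * trig_poly {..<M} c (cell_freq M) w"
      unfolding trig_poly_def sum_distrib_left
    proof (intro sum.cong refl)
      fix m
      have "cis (- 2 * pi * w * ((real m + 1 / 2) / M)) = cis (- pi * w) * cis (2 * pi * cell_freq M m * w)"
        unfolding cis_mult
        by (rule arg_cong[where f = cis]) (use M in \<open>simp add: cell_freq_def field_simps\<close>)
      then show "(c m * sqrt M) * (cis (- 2 * pi * w * ((real m + 1 / 2) / M)) * (?s / M))
          = (sqrt M * (?s / M) * cis (- pi * w)) * (c m * cis (2 * pi * cell_freq M m * w))"
        by (simp only: mult_ac of_real_mult)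
    qed
    finally have "(cmod (fourier f w))\<^sup>2 = (sqrt M * (\<bar>?s\<bar> / M))\<^sup>2 * (cmod (trig_poly {..<M} c (cell_freq M) w))\<^sup>2"
      by (simp add: norm_mult norm_divide power_mult_distrib power_divide)
    also have "(sqrt M * (\<bar>?s\<bar> / M))\<^sup>2 = ?s\<^sup>2 / M"
      using M by (simp add: power_mult_distrib power_divide) (simp add: power2_eq_square)
    finally show ?thesis .
  qed
  ultimately show ?thesis using that by blast
qed

text \<open>The slack below \<open>1 / 2\<close> leaves room for the frequency shift by
  \<open>1 / (4 * M)\<close> that the cosine window causes.\<close>

lemma cell_freq_bound:
  assumes "m < M"
  shows "\<bar>cell_freq M m\<bar> \<le> 1 / 2 - 1 / (2 * real M)"
proof -
  have "1 / 2 \<le> real m + 1 / 2" "real m + 1 / 2 \<le> real M - 1 / 2" using assms by linarith+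
  then have "(1 / 2) / real M \<le> (real m + 1 / 2) / M" "(real m + 1 / 2) / M \<le> (real M - 1 / 2) / M"
    by (intro divide_right_mono; simp)+
  moreover have "(1 / 2) / real M = 1 / (2 * real M)" by simp
  moreover have "(real M - 1 / 2) / M = 1 - 1 / (2 * real M)" using assms by (simp add: field_simps)
  ultimately show ?thesis unfolding cell_freq_def abs_le_iff by simp
qed

lemma cell_freq_diff: "0 < M \<Longrightarrow> (cell_freq M j - cell_freq M k) * M = real k - real j"
  by (simp add: cell_freq_def field_simps)

text \<open>Only the modulus is periodic: the frequencies differ by multiples of
  \<open>1 / M\<close>, so a shift by \<open>M\<close> multiplies all terms by the same
  phase.\<close>

lemma cmod_cell_poly_periodic:
  assumes "0 < M"
  shows "cmod (trig_poly {..<M} c (cell_freq M) (t + real M)) = cmod (trig_poly {..<M} c (cell_freq M) t)"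
proof -
  have "cis (2 * pi * cell_freq M m * (t + real M)) = cis (pi * (real M - 1)) * cis (2 * pi * cell_freq M m * t)" for m
  proof -
    have "2 * pi * cell_freq M m * (t + real M) = pi * (real M - 1) + 2 * pi * cell_freq M m * t - 2 * pi * real m"
      using assms by (simp add: cell_freq_def field_simps)
    moreover have "cis (x - 2 * pi * real m) = cis x" for x
      using cis_multiple_2pi[of "real m"] by (simp add: cis_divide[symmetric])
    ultimately show ?thesis by (simp add: cis_mult)
  qed
  then have "trig_poly {..<M} c (cell_freq M) (t + real M) = cis (pi * (real M - 1)) * trig_poly {..<M} c (cell_freq M) t"
    by (simp add: trig_poly_def sum_distrib_left mult_ac)
  then show ?thesis by (simp add: norm_mult)
qed

lemma sum_Times_bool: "(\<Sum>p\<in>A \<times> (UNIV :: bool set). g p) = (\<Sum>m\<in>A. g (m, False) + g (m, True))"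
  using sum.cartesian_product[of "\<lambda>m b. g (m, b)" "UNIV :: bool set" A]
  by (simp add: split_def UNIV_bool add.commute)

section \<open>Lower bounds for samples of step functions\<close>

context sampling_scheme begin

text \<open>\<open>u n\<close> stands for the squared modulus of the polynomial actually sampled,
  \<open>h\<close> for that of the cell polynomial. They differ by the window, if there is one, and
  \<kappa> compares the window with sinc.\<close>

lemma samples_lower:
  assumes M: "0 < (M :: nat)" and A: "A \<subseteq> {1..N}"
    and fh: "\<And>w. (cmod (fourier f w))\<^sup>2 = (sinc_cont (pi * w / M))\<^sup>2 / M * h w"
    and dom: "\<And>n. n \<in> A \<Longrightarrow> \<kappa>\<^sup>2 * u n \<le> (sinc_cont (pi * X n / M))\<^sup>2 * h (X n)"
    and E: "(1 - \<delta>)\<^sup>2 * (real M * S) \<le> (\<Sum>n\<in>A. \<mu> n * u n)"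
  shows "\<kappa>\<^sup>2 * (1 - \<delta>)\<^sup>2 * S \<le> (\<Sum>n=1..N. \<mu> n * (cmod (fourier f (X n)))\<^sup>2)"
proof -
  have "\<kappa>\<^sup>2 * (1 - \<delta>)\<^sup>2 * S = \<kappa>\<^sup>2 / M * ((1 - \<delta>)\<^sup>2 * (M * S))" using M by simp
  also have "\<dots> \<le> \<kappa>\<^sup>2 / M * (\<Sum>n\<in>A. \<mu> n * u n)" using E by (intro mult_left_mono) auto
  also have "\<dots> = (\<Sum>n\<in>A. \<mu> n * (\<kappa>\<^sup>2 * u n / M))" by (simp add: sum_distrib_left mult_ac)
  also have "\<dots> \<le> (\<Sum>n\<in>A. \<mu> n * (cmod (fourier f (X n)))\<^sup>2)"
    using \<mu>_nonneg A dom by (intro sum_mono mult_left_mono) (auto simp: fh divide_right_mono)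
  also have "\<dots> \<le> (\<Sum>n=1..N. \<mu> n * (cmod (fourier f (X n)))\<^sup>2)"
    using \<mu>_nonneg A by (intro sum_mono2) auto
  finally show ?thesis .
qed

text \<open>The sampling geometry enters as a premise on all curves of periodic modulus, since the
  polynomial arises only inside the proof. Sinc decreases on \<open>[0, pi]\<close>, so modulus
  \<rho> is the worst case.\<close>

lemma samples_lower_sinc:
  assumes M: "0 < (M :: nat)" and f: "f \<in> U_space M" and \<rho>: "0 < \<rho>" "\<rho> \<le> real M"
    and E: "\<And>u u'. C1_curve u u' \<Longrightarrow> (\<And>t. cmod (u (t + real M)) = cmod (u t)) \<Longrightarrow>
      \<exists>\<alpha>. C1_curve.energy u u' (- \<delta>) \<alpha> (\<alpha> + real M) \<le> (\<Sum>n | n \<in> {1..N} \<and> \<bar>X n\<bar> \<le> \<rho>. \<mu> n * (cmod (u (X n)))\<^sup>2)"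
  shows "(sinc_fn (pi * \<rho> / M))\<^sup>2 * (1 - \<delta>)\<^sup>2 * (L2_norm f)\<^sup>2 \<le> (\<Sum>n=1..N. \<mu> n * (cmod (fourier f (X n)))\<^sup>2)"
proof -
  obtain c where c: "(L2_norm f)\<^sup>2 = (\<Sum>m<M. (cmod (c m))\<^sup>2)"
    and fh: "\<And>w. (cmod (fourier f w))\<^sup>2 = (sinc_cont (pi * w / M))\<^sup>2 / M * (cmod (trig_poly {..<M} c (cell_freq M) w))\<^sup>2"
    using U_space_expansion[OF f M] by metis
  let ?H = "trig_poly {..<M} c (cell_freq M)"
  let ?A = "{n. n \<in> {1..N} \<and> \<bar>X n\<bar> \<le> \<rho>}"
  obtain \<alpha> where "C1_curve.energy ?H (trig_poly {..<M} (\<lambda>j. c j * (\<i> * (2 * pi * cell_freq M j))) (cell_freq M)) (- \<delta>) \<alpha> (\<alpha> + real M)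
      \<le> (\<Sum>n\<in>?A. \<mu> n * (cmod (?H (X n)))\<^sup>2)"
    using E[OF trig_poly_C1 cmod_cell_poly_periodic[OF M]] by blast
  moreover have "(1 - \<delta>)\<^sup>2 * (real M * (\<Sum>m<M. (cmod (c m))\<^sup>2))
      \<le> C1_curve.energy ?H (trig_poly {..<M} (\<lambda>j. c j * (\<i> * (2 * pi * cell_freq M j))) (cell_freq M)) (- \<delta>) \<alpha> (\<alpha> + real M)"
  proof (rule energy_trig_poly_ge)
    fix j k assume "j \<in> {..<M}" "k \<in> {..<M}" "j \<noteq> k"
    then show "\<exists>n::int. n \<noteq> 0 \<and> (cell_freq M j - cell_freq M k) * real M = n"
      using M by (intro exI[of _ "int k - int j"]) (simp add: cell_freq_diff)
  next
    fix j assume "j \<in> {..<M}"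
    then have "\<bar>cell_freq M j\<bar> \<le> 1 / 2 - 1 / (2 * real M)" by (intro cell_freq_bound) simp
    also have "\<dots> \<le> 1 / 2" by simp
    finally show "\<bar>cell_freq M j\<bar> \<le> 1 / 2" .
  qed (use \<delta>_pos \<delta>_less_1 in auto)
  ultimately have E': "(1 - \<delta>)\<^sup>2 * (real M * (L2_norm f)\<^sup>2) \<le> (\<Sum>n\<in>?A. \<mu> n * (cmod (?H (X n)))\<^sup>2)"
    using c by simp
  show ?thesis
  proof (rule samples_lower[OF M _ fh _ E'])
    fix n assume n: "n \<in> ?A"
    have y: "pi * \<rho> / M \<le> pi" "0 < pi * \<rho> / M" using \<rho> M by (auto simp: field_simps)
    have "\<bar>pi * X n / M\<bar> \<le> pi * \<rho> / M" using n M by (auto simp: abs_mult divide_right_mono)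
    then have "sinc_fn (pi * \<rho> / M) \<le> sinc_cont (pi * X n / M)" using y by (intro sinc_cont_ge)
    moreover have "0 \<le> sinc_fn (pi * \<rho> / M)"
      using y unfolding sinc_fn_def by (metis divide_nonneg_pos less_imp_le sin_ge_zero)
    ultimately show "(sinc_fn (pi * \<rho> / M))\<^sup>2 * (cmod (?H (X n)))\<^sup>2 \<le> (sinc_cont (pi * X n / M))\<^sup>2 * (cmod (?H (X n)))\<^sup>2"
      by (intro mult_right_mono power_mono) auto
  qed auto
qed

lemma samples_lower_critical:
  assumes M: "0 < (M :: nat)" and f: "f \<in> U_space M" and K: "2 * K = real M"
  shows "(2 / pi)\<^sup>2 * (1 - \<delta>)\<^sup>2 * (L2_norm f)\<^sup>2 \<le> (\<Sum>n=1..N. \<mu> n * (cmod (fourier f (X n)))\<^sup>2)"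
proof -
  have "{n. n \<in> {1..N} \<and> \<bar>X n\<bar> \<le> real M / 2} = {1..N}"
    using X_bounds K by (force simp: abs_le_iff)
  moreover have "X N \<le> X 1 + real M" using X_bounds[of 1] X_bounds[of N] N_pos K by simp
  ultimately have "\<exists>\<alpha>. C1_curve.energy u u' (- \<delta>) \<alpha> (\<alpha> + real M)
      \<le> (\<Sum>n | n \<in> {1..N} \<and> \<bar>X n\<bar> \<le> real M / 2. \<mu> n * (cmod (u (X n)))\<^sup>2)"
    if "C1_curve u u'" "\<And>t. cmod (u (t + real M)) = cmod (u t)" for u u'
    using sampled_curve.lower_all_nodes[of K \<delta> N w u u' "real M"] that K
    by (auto simp: sampled_curve_def sampling_scheme_axioms intro!: exI[of _ "X 1"])
  then have "(sinc_fn (pi * (real M / 2) / M))\<^sup>2 * (1 - \<delta>)\<^sup>2 * (L2_norm f)\<^sup>2 \<le> (\<Sum>n=1..N. \<mu> n * (cmod (fourier f (X n)))\<^sup>2)"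
    using M by (intro samples_lower_sinc f) auto
  moreover have "sinc_fn (pi * (real M / 2) / M) = 2 / pi" using M by (simp add: sinc_fn_def)
  ultimately show ?thesis by simp
qed

lemma samples_lower_near_critical:
  assumes M: "2 \<le> (M :: nat)" and f: "f \<in> U_space M" and K: "real M \<le> 2 * K"
  shows "(sinc_fn (pi / 2 + pi * \<delta> / M))\<^sup>2 * (1 - \<delta>)\<^sup>2 * (L2_norm f)\<^sup>2 \<le> (\<Sum>n=1..N. \<mu> n * (cmod (fourier f (X n)))\<^sup>2)"
proof -
  have "(sinc_fn (pi * (real M / 2 + \<delta>) / M))\<^sup>2 * (1 - \<delta>)\<^sup>2 * (L2_norm f)\<^sup>2 \<le> (\<Sum>n=1..N. \<mu> n * (cmod (fourier f (X n)))\<^sup>2)"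
    using M K \<delta>_pos \<delta>_less_1
    by (intro samples_lower_sinc f sampled_curve.lower_near_period)
      (auto simp: sampled_curve_def sampling_scheme_axioms)
  moreover have "pi * (real M / 2 + \<delta>) / M = pi / 2 + pi * \<delta> / M" using M by (simp add: field_simps)
  ultimately show ?thesis by simp
qed

text \<open>The window \<open>cos (pi t / (2 M))\<close> on \<open>[-M, M]\<close> lies below \<open>pi / 2 * sinc (pi t / M)\<close> by Jordan's inequality,
  vanishes at both ends, and splits every frequency of the cell polynomial into two that are still
  bounded by \<open>1/2\<close> and orthogonal over \<open>[-M, M]\<close>.\<close>

lemma samples_lower_oversampled:
  assumes M: "0 < (M :: nat)" and f: "f \<in> U_space M" and K: "real M \<le> K"
  shows "(2 / pi)\<^sup>2 * (1 - \<delta>)\<^sup>2 * (L2_norm f)\<^sup>2 \<le> (\<Sum>n=1..N. \<mu> n * (cmod (fourier f (X n)))\<^sup>2)"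
proof -
  obtain c where c: "(L2_norm f)\<^sup>2 = (\<Sum>m<M. (cmod (c m))\<^sup>2)"
    and fh: "\<And>w. (cmod (fourier f w))\<^sup>2 = (sinc_cont (pi * w / M))\<^sup>2 / M * (cmod (trig_poly {..<M} c (cell_freq M) w))\<^sup>2"
    using U_space_expansion[OF f M] by metis
  let ?H = "trig_poly {..<M} c (cell_freq M)"
  let ?A = "{n. n \<in> {1..N} \<and> \<bar>X n\<bar> \<le> real M}"
  define J where "J = {..<M} \<times> (UNIV :: bool set)"
  define d where "d = (\<lambda>(m, b :: bool). c m / 2)"
  \<comment> \<open>The cosine is half the sum of the exponentials with frequencies plus and minus
    \<open>1 / (4 * M)\<close>; the flag selects the sign.\<close>
  define \<nu> where "\<nu> = (\<lambda>(m, b). cell_freq M m + (if b then 1 else - 1) / (4 * real M))"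
  let ?G = "trig_poly J d \<nu>"
  have G: "?G t = cos (pi * t / (2 * M)) * ?H t" for t
  proof -
    have "cis (2 * pi * (x + 1 / (4 * real M)) * t) + cis (2 * pi * (x + - 1 / (4 * real M)) * t)
        = 2 * cos (pi * t / (2 * M)) * cis (2 * pi * x * t)" for x
    proof -
      have "2 * pi * (x + 1 / (4 * real M)) * t = 2 * pi * x * t + pi * t / (2 * M)"
        "2 * pi * (x + - 1 / (4 * real M)) * t = 2 * pi * x * t + - (pi * t / (2 * M))"
        using M by (simp_all add: field_simps)
      then show ?thesis
        unfolding cis_mult[symmetric] by (simp only:) (simp add: complex_eq_iff cos_add cos_diff sin_add sin_diff algebra_simps)
    qed
    then have "c m / 2 * cis (2 * pi * (cell_freq M m + - 1 / (4 * real M)) * t)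
        + c m / 2 * cis (2 * pi * (cell_freq M m + 1 / (4 * real M)) * t)
        = cos (pi * t / (2 * M)) * (c m * cis (2 * pi * cell_freq M m * t))" for m
      unfolding distrib_left[symmetric] by (subst add.commute) (simp only: mult_ac, simp)
    then show ?thesis
      unfolding trig_poly_def J_def sum_Times_bool sum_distrib_left by (simp add: d_def \<nu>_def)
  qed
  interpret sampled_curve K \<delta> N w ?G "trig_poly J (\<lambda>j. d j * (\<i> * (2 * pi * \<nu> j))) \<nu>"
    unfolding sampled_curve_def using sampling_scheme_axioms trig_poly_C1 by blast
  have "energy (- \<delta>) (- real M) (real M) \<le> (\<Sum>n\<in>?A. \<mu> n * (cmod (?G (X n)))\<^sup>2)"
    using M K by (intro lower_zeros) (auto simp: G)
  moreover have "(1 - \<delta>)\<^sup>2 * (2 * real M * (\<Sum>j\<in>J. (cmod (d j))\<^sup>2)) \<le> energy (- \<delta>) (- real M) (- real M + 2 * real M)"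
  proof (rule energy_trig_poly_ge)
    fix p q assume pq: "p \<in> J" "q \<in> J" "p \<noteq> q"
    obtain j a k b where p: "p = (j, a)" and q: "q = (k, b)" by (cases p, cases q) auto
    \<comment> \<open>Parity separates the frequencies: with equal flags \<open>?n\<close> is twice
      a nonzero integer, otherwise it is odd.\<close>
    let ?n = "2 * (int k - int j) + (if a then (if b then 0 else 1) else (if b then - 1 else 0))"
    have "(\<nu> p - \<nu> q) * (2 * real M) = 2 * ((cell_freq M j - cell_freq M k) * M) + ((if a then 1 else - 1) - (if b then 1 else - 1)) / 2"
      using M by (simp add: \<nu>_def p q field_simps)
    also have "\<dots> = ?n" using M by (simp add: cell_freq_diff)
    finally have "(\<nu> p - \<nu> q) * (2 * real M) = ?n" .
    moreover have "?n \<noteq> 0" using pq by (auto simp: p q split: if_splits) presburger+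
    ultimately show "\<exists>n::int. n \<noteq> 0 \<and> (\<nu> p - \<nu> q) * (2 * real M) = n"
      by (intro exI[of _ ?n] conjI) (simp_all only: of_int_eq_0_iff not_False_eq_True)
  next
    fix p assume "p \<in> J"
    then obtain m b where p: "p = (m, b)" "m < M" by (auto simp: J_def)
    have "\<bar>\<nu> p\<bar> \<le> \<bar>cell_freq M m\<bar> + 1 / (4 * real M)"
      using abs_triangle_ineq[of "cell_freq M m" "(if b then 1 else - 1) / (4 * real M)"]
      by (cases b) (simp_all add: \<nu>_def p)
    moreover have "1 / (4 * real M) \<le> 1 / (2 * real M)" using M by (simp add: field_simps)
    ultimately show "\<bar>\<nu> p\<bar> \<le> 1 / 2" using cell_freq_bound[OF p(2)] by linarith
  qed (use \<delta>_pos \<delta>_less_1 in \<open>auto simp: J_def\<close>)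
  \<comment> \<open>The doubled length is offset exactly: each coefficient splits into two halves
    whose squares add up to half of its square.\<close>
  moreover have "2 * real M * (\<Sum>j\<in>J. (cmod (d j))\<^sup>2) = real M * (L2_norm f)\<^sup>2"
    by (simp add: c J_def d_def sum_Times_bool norm_divide power_divide sum_distrib_left)
  ultimately have E: "(1 - \<delta>)\<^sup>2 * (real M * (L2_norm f)\<^sup>2) \<le> (\<Sum>n\<in>?A. \<mu> n * (cmod (?G (X n)))\<^sup>2)"
    by simp
  show ?thesis
  proof (rule samples_lower[OF M _ fh _ E])
    fix n assume n: "n \<in> ?A"
    have x: "\<bar>pi * X n / M\<bar> \<le> pi" using n M by (auto simp: abs_mult field_simps)
    let ?\<theta> = "pi * X n / (2 * M)"
    have half: "?\<theta> = pi * X n / M / 2" by simp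
    have "2 / pi * cos ?\<theta> \<le> sinc_cont (pi * X n / M)" unfolding half by (rule sinc_cont_ge_cos[OF x])
    moreover have "\<bar>?\<theta>\<bar> \<le> pi / 2" unfolding half
      using divide_right_mono[OF x, of 2] by (simp only: abs_divide abs_numeral)
    then have "0 \<le> cos ?\<theta>" by (intro cos_ge_zero) linarith+
    ultimately have "(2 / pi * cos ?\<theta>)\<^sup>2 * (cmod (?H (X n)))\<^sup>2 \<le> (sinc_cont (pi * X n / M))\<^sup>2 * (cmod (?H (X n)))\<^sup>2"
      by (intro mult_right_mono power_mono) auto
    then show "(2 / pi)\<^sup>2 * (cmod (?G (X n)))\<^sup>2 \<le> (sinc_cont (pi * X n / M))\<^sup>2 * (cmod (?H (X n)))\<^sup>2"
      unfolding G norm_mult norm_of_real power_mult_distrib power2_abs mult.assoc .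
  qed auto
qed

text \<open>Positivity and boundedness are claimed as well, because division by a zero
  \<open>C1\<close> yields 0 and \<open>Sup\<close> of an unbounded set is unspecified; the estimate
  of \<open>Cconst\<close> alone would not exclude such values.\<close>

lemma Cconst_le:
  assumes T: "T \<subseteq> H_space" "\<exists>f\<in>T. L2_norm f \<noteq> 0" and \<kappa>: "0 < \<kappa>"
    and lower: "\<And>f. f \<in> T \<Longrightarrow> \<kappa>\<^sup>2 * (1 - \<delta>)\<^sup>2 * (L2_norm f)\<^sup>2 \<le> (\<Sum>n=1..N. \<mu> n * (cmod (fourier f (X n)))\<^sup>2)"
  shows "0 < C1 K N w T \<and> bdd_above {Sratio K N w f | f. f \<in> H_space \<and> L2_norm f \<noteq> 0} \<and>
    Cconst K N w T \<le> 1 / \<kappa> * ((1 + \<delta>) / (1 - \<delta>))"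
proof -
  let ?L = "\<kappa>\<^sup>2 * (1 - \<delta>)\<^sup>2"
  have up: "Sratio K N w f \<le> (1 + \<delta>)\<^sup>2" if "f \<in> H_space" "L2_norm f \<noteq> 0" for f
    using samples_upper[OF that(1)] that(2) by (simp add: Sratio_def inner_sampling_op[OF that(1)] divide_le_eq)
  have lo: "?L \<le> Sratio K N w f" if "f \<in> T" "L2_norm f \<noteq> 0" for f
    using lower[OF that(1)] that T inner_sampling_op[of f] by (auto simp: Sratio_def le_divide_eq)
  have L: "0 < ?L" using \<kappa> \<delta>_less_1 by simp
  have C1: "?L \<le> C1 K N w T"
    unfolding C1_def using T lo by (intro cInf_greatest) auto
  \<comment> \<open>\<open>T\<close> supplies an element of \<open>H_space\<close> with nonzero
    norm, so the supremum is over a nonempty set.\<close>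
  have C2: "C2 K N w \<le> (1 + \<delta>)\<^sup>2"
    unfolding C2_def using T up by (intro cSup_least) auto
  have bdd: "bdd_above {Sratio K N w f | f. f \<in> H_space \<and> L2_norm f \<noteq> 0}"
    using up by (intro bdd_aboveI) auto
  have "C2 K N w / C1 K N w T \<le> (1 + \<delta>)\<^sup>2 / C1 K N w T"
    using C2 C1 L by (intro divide_right_mono) auto
  also have "\<dots> \<le> (1 + \<delta>)\<^sup>2 / ?L" using C1 L by (intro divide_left_mono) auto
  also have "\<dots> = (1 / \<kappa> * ((1 + \<delta>) / (1 - \<delta>)))\<^sup>2" by (simp add: power_mult_distrib power_divide)
  finally have "Cconst K N w T \<le> sqrt ((1 / \<kappa> * ((1 + \<delta>) / (1 - \<delta>)))\<^sup>2)"
    unfolding Cconst_def by (rule real_sqrt_le_mono)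
  moreover have "0 \<le> 1 / \<kappa> * ((1 + \<delta>) / (1 - \<delta>))" using \<kappa> \<delta>_pos \<delta>_less_1 by simp
  ultimately show ?thesis using bdd C1 L by (simp only: real_sqrt_abs abs_of_nonneg) auto
qed

end

theorem theorem5p7:
  fixes K \<delta> :: real and N M :: nat and w :: "nat \<Rightarrow> real"
    and T :: "(real \<Rightarrow> complex) set"
  assumes dense: "KD_dense K \<delta> N w"
    and M_pos: "0 < M" and M_le: "real M \<le> 2 * K"
    and T_sub: "is_csubspace T" and T_U: "T \<subseteq> U_space M"
    and T_nz: "\<exists>f\<in>T. L2_norm f \<noteq> 0"
  shows "(2 * K / real M \<in> \<nat> \<longrightarrow>
            0 < C1 K N w T \<and>
            bdd_above {Sratio K N w f | f. f \<in> H_space \<and> L2_norm f \<noteq> 0} \<and>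
            Cconst K N w T \<le> pi / 2 * ((1 + \<delta>) / (1 - \<delta>)))
       \<and> (2 * K / real M \<notin> \<nat> \<and> 2 \<le> M \<longrightarrow>
            0 < C1 K N w T \<and>
            bdd_above {Sratio K N w f | f. f \<in> H_space \<and> L2_norm f \<noteq> 0} \<and>
            Cconst K N w T \<le> (1 / sinc_fn (pi / 2 + pi * \<delta> / real M)) * ((1 + \<delta>) / (1 - \<delta>)))
       \<and> ((\<lambda>m::nat. 1 / sinc_fn (pi / 2 + pi * \<delta> / real m)) \<longlonglongrightarrow> pi / 2)"
proof (intro conjI[of "_ \<longrightarrow> _"] impI)
  interpret sampling_scheme K \<delta> N w by unfold_locales (rule dense)
  have T_H: "T \<subseteq> H_space" using T_U U_space_expansion[OF _ M_pos] by blast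
  {
    assume nat: "2 * K / real M \<in> \<nat>"
    then obtain k :: nat where "2 * K / real M = real k" by (elim Nats_cases)
    then have k: "2 * K = real k * real M" using M_pos by (simp add: field_simps)
    have "(2 / pi)\<^sup>2 * (1 - \<delta>)\<^sup>2 * (L2_norm f)\<^sup>2 \<le> (\<Sum>n=1..N. \<mu> n * (cmod (fourier f (X n)))\<^sup>2)" if "f \<in> T" for f
    proof -
      have f: "f \<in> U_space M" using that T_U by auto
      \<comment> \<open>\<open>k = 0\<close> contradicts \<open>M \<le> 2 * K\<close>, and
        \<open>2 \<le> k\<close> means \<open>M \<le> K\<close>, which makes room for the window on
        \<open>[-M, M]\<close>.\<close>
      consider "k = 0" | "k = 1" | "2 \<le> k" by linarith
      then show ?thesis
      proof cases
        case 1
        then show ?thesis using k M_le M_pos by simp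
      next
        case 2
        then show ?thesis using samples_lower_critical[OF M_pos f] k by simp
      next
        case 3
        then have "2 * real M \<le> real k * real M" by (intro mult_right_mono) auto
        then show ?thesis using samples_lower_oversampled[OF M_pos f] k by simp
      qed
    qed
    from Cconst_le[OF T_H T_nz _ this]
    show "0 < C1 K N w T \<and>
            bdd_above {Sratio K N w f | f. f \<in> H_space \<and> L2_norm f \<noteq> 0} \<and>
            Cconst K N w T \<le> pi / 2 * ((1 + \<delta>) / (1 - \<delta>))" by simp
  next
    assume "2 * K / real M \<notin> \<nat> \<and> 2 \<le> M"
    then have M2: "2 \<le> M" by simp
    \<comment> \<open>\<open>2 \<le> M\<close> and \<open>\<delta> < 1\<close> keep the argument of
      sinc below \<open>pi\<close>, where sinc is positive.\<close>
    have "pi * \<delta> < pi / 2 * real M"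
    proof -
      have "pi * \<delta> < pi * 1" using \<delta>_less_1 by (intro mult_strict_left_mono) auto
      also have "\<dots> \<le> pi / 2 * real M" using M2 by simp
      finally show ?thesis .
    qed
    then have "pi / 2 + pi * \<delta> / real M < pi" using M_pos by (simp add: field_simps)
    moreover have "0 < pi / 2 + pi * \<delta> / real M" using \<delta>_pos by (simp add: add_pos_nonneg)
    ultimately have "0 < sinc_fn (pi / 2 + pi * \<delta> / real M)"
      unfolding sinc_fn_def by (intro divide_pos_pos sin_gt_zero)
    then show "0 < C1 K N w T \<and>
            bdd_above {Sratio K N w f | f. f \<in> H_space \<and> L2_norm f \<noteq> 0} \<and>
            Cconst K N w T \<le> (1 / sinc_fn (pi / 2 + pi * \<delta> / real M)) * ((1 + \<delta>) / (1 - \<delta>))"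
      using T_U M_le by (intro Cconst_le T_H T_nz samples_lower_near_critical M2) auto
  next
    have "(\<lambda>m::nat. pi * \<delta> / real m) \<longlonglongrightarrow> 0"
      by (rule tendsto_divide_0[OF tendsto_const filterlim_real_at_infinity_sequentially])
    then have lim: "(\<lambda>m::nat. pi / 2 + pi * \<delta> / real m) \<longlonglongrightarrow> pi / 2 + 0"
      by (intro tendsto_intros)
    have "(\<lambda>m::nat. 1 / (sin (pi / 2 + pi * \<delta> / real m) / (pi / 2 + pi * \<delta> / real m)))
        \<longlonglongrightarrow> 1 / (sin (pi / 2 + 0) / (pi / 2 + 0))"
      by (intro tendsto_divide tendsto_sin tendsto_const lim) auto
    then show "(\<lambda>m::nat. 1 / sinc_fn (pi / 2 + pi * \<delta> / real m)) \<longlonglongrightarrow> pi / 2"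
      by (simp add: sinc_fn_def)
  }
qed

end
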